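(* Let $s \geq 3$ and $k \geq 2$ be integers and let $q$ be a prime power. For a positive integer $m$ write $[m]_q = \frac{q^m-1}{q-1}$. (Upper bound.) Let $n$ be a positive integer and let $\mathcal{F}$ be a family of $k$-dimensional subspaces of $V(n,q) = \mathbb{F}_q^n$ that contains no $s$-sunflower. Then \[ |\mathcal{F}| \le \prod_{i=1}^{k} [i(s-1)]_q \le \Big(\frac{q}{q-1}\Big)^k q^{(s-1)\binom{k+1}{2}-k}. \] (Lower bounds.) There exist a positive integer $n$ and a family $\mathcal{F}$ of $k$-dimensional subspaces of $V(n,q)$ containing no $s$-sunflower such that: \begin{enumerate} \item if $s \geq k+1$, then $|\mathcal{F}| \geq q^{(s-1)\binom{k+1}{2}-k}$; \item if $s \leq k$, then $|\mathcal{F}| \geq q^{(s-2)\binom{k+1}{2} + k\frac{\gcd(k,s-1)-3}{2}} \geq q^{(s-2)\binom{k+1}{2}-k}$. \end{enumerate}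
   Context: $V(n,q)$ denotes the $n$-dimensional vector space over the finite field $\mathbb{F}_q$; a $k$-space means a $k$-dimensional subspace. A family of subspaces is a set (not a multiset). A collection of $s$ distinct $k$-spaces $S_1,\ldots,S_s$ is an $s$-sunflower with kernel $K$ if there is a $d$-dimensional subspace $K$ with $K = S_i \cap S_j$ for all distinct $i,j$ and the quotients $S_1/K,\ldots,S_s/K$ are in general position, i.e. $\dim(S_1+\cdots+S_s) = d + s(k-d)$. A family is $s$-sunflower-free if it contains no $s$-sunflower. *)

theory Defs
  imports Complex_Main "HOL-Library.Function_Algebras"
begin

definition fscale :: "'a::field \<Rightarrow> (nat \<Rightarrow> 'a) \<Rightarrow> nat \<Rightarrow> 'a" where
  "fscale c v = (\<lambda>i. c * v i)"

interpretation fn: vector_space "fscale :: 'a::field \<Rightarrow> (nat \<Rightarrow> 'a) \<Rightarrow> nat \<Rightarrow> 'a"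
  by unfold_locales (auto simp: fscale_def fun_eq_iff algebra_simps)

text \<open>
  The coordinate space of dimension \<open>n\<close> over the field \<open>'a\<close>: vectors with coordinates
  indexed by \<open>{..<n}\<close>, padded with zeros. Keeping \<open>n\<close> a term rather than a type allows it
  to be quantified inside formulas.
\<close>
definition coord_space :: "nat \<Rightarrow> (nat \<Rightarrow> 'a::field) set" where
  "coord_space n = {v. \<forall>i\<ge>n. v i = 0}"

definition kspaces :: "nat \<Rightarrow> nat \<Rightarrow> (nat \<Rightarrow> 'a::field) set set" where
  "kspaces n k = {S. S \<subseteq> coord_space n \<and> fn.subspace S \<and> fn.dim S = k}"

text \<open>
  The span of the union is the sum \<open>S\<^sub>1 + \<dots> + S\<^sub>s\<close> of the members. For \<open>s \<ge> 2\<close> the kernel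
  is contained in a member, so \<open>d \<le> k\<close> and the subtraction does not truncate.
\<close>
definition sunflower :: "nat \<Rightarrow> nat \<Rightarrow> nat \<Rightarrow> (nat \<Rightarrow> 'a::field) set set \<Rightarrow> bool" where
  "sunflower n k s \<S> \<longleftrightarrow>
     \<S> \<subseteq> kspaces n k \<and> finite \<S> \<and> card \<S> = s \<and>
     (\<exists>d. \<exists>K \<in> kspaces n d.
        (\<forall>S\<in>\<S>. \<forall>T\<in>\<S>. S \<noteq> T \<longrightarrow> S \<inter> T = K) \<and>
        fn.dim (fn.span (\<Union>\<S>)) = d + s * (k - d))"

definition sunflower_free :: "nat \<Rightarrow> nat \<Rightarrow> nat \<Rightarrow> (nat \<Rightarrow> 'a::field) set set \<Rightarrow> bool" where
  "sunflower_free n k s \<F> \<longleftrightarrow> \<not> (\<exists>\<S>\<subseteq>\<F>. sunflower n k s \<S>)"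

definition qint :: "nat \<Rightarrow> nat \<Rightarrow> real" where
  "qint q m = (real q ^ m - 1) / (real q - 1)"

end

theory Submission
  imports Defs "HOL-Algebra.Algebraic_Closure_Type"
begin

text \<open>
  Upper bound: choose \<open>t < s\<close> members of the family that are maximal in general position modulo a
  common subspace \<open>W\<close> of codimension \<open>j\<close> in each of them. Every member meets their sum \<open>U\<close> in more
  than \<open>W\<close>, so it contains one of the \<open>[t j]\<^sub>q\<close> one-step extensions of \<open>W\<close> inside \<open>U\<close>. Induct on \<open>j\<close>.

  Lower bounds: take graphs of linear maps on a \<open>k\<close>-dimensional space, with values in consecutive
  blocks of \<open>(s - 1) t\<close> coordinates, where \<open>t = \<lceil>k / (s - 1)\<rceil>\<close>, the \<open>j\<close>-th block (\<open>j = 1, 2, \<dots>\<close>)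
  running through a Gabidulin code of minimum rank distance \<open>j t\<close>. Maps that agree on a subspace of
  codimension \<open>r\<close> differ in the first \<open>(s - 1) r\<close> coordinates only, whereas a sunflower needs that many
  independent differences. Fixing the first coordinate, at the cost of a factor \<open>q\<^sup>k\<close>, leaves one
  dimension too few.
\<close>

section \<open>Cardinalities of spans, subspaces and sums over a finite field\<close>

lemma (in vector_space) card_span_insert:
  assumes "finite (UNIV :: 'a set)" and "finite (span S)" and "u \<notin> span S"
  shows "finite (span (insert u S))"
    and "card (span (insert u S)) = card (UNIV :: 'a set) * card (span S)"
proof -
  let ?f = "\<lambda>(c, x). x + scale c u"
  have eq: "span (insert u S) = ?f ` (UNIV \<times> span S)"
  proof (intro equalityI subsetI)
    fix y assume "y \<in> span (insert u S)"
    then obtain c where "y - scale c u \<in> span S"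
      by (auto simp: span_insert)
    then show "y \<in> ?f ` (UNIV \<times> span S)"
      by (intro image_eqI[of _ _ "(c, y - scale c u)"]) auto
  next
    fix y assume "y \<in> ?f ` (UNIV \<times> span S)"
    then obtain c x where "y = x + scale c u" "x \<in> span S"
      by auto
    then show "y \<in> span (insert u S)"
      by (auto simp: span_insert intro!: exI[of _ c])
  qed
  have inj: "inj_on ?f (UNIV \<times> span S)"
  proof (rule inj_onI, clarsimp)
    fix c x d y
    assume x: "x \<in> span S" and y: "y \<in> span S" and e: "x + scale c u = y + scale d u"
    have d: "scale (c - d) u = y - x"
      using e by (simp add: scale_left_diff_distrib algebra_simps)
    have "c = d"
    proof (rule ccontr)
      assume "c \<noteq> d"
      then have "u = scale (inverse (c - d)) (y - x)"
        unfolding d[symmetric] by simp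
      with x y assms(3) show False
        by (metis span_diff span_scale)
    qed
    with e show "c = d \<and> x = y" by simp
  qed
  show "finite (span (insert u S))"
    unfolding eq using assms by auto
  show "card (span (insert u S)) = card (UNIV :: 'a set) * card (span S)"
    unfolding eq card_image[OF inj] by (rule card_cartesian_product)
qed

lemma (in vector_space) card_span_independent:
  assumes "finite (UNIV :: 'a set)" and "finite B" and "independent B"
  shows "finite (span B) \<and> card (span B) = card (UNIV :: 'a set) ^ card B"
  using assms(2,3)
proof (induction B rule: finite_induct)
  case (insert u B)
  then have "independent B" "u \<notin> span B"
    using independent_insert by auto
  with insert card_span_insert[OF assms(1), of B u] show ?case
    by simp
qed simp

text \<open>Replaces dimensions by cardinalities; most later dimension arguments are carried out by
  counting vectors.\<close>

lemma (in vector_space) card_subspace: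
  assumes "finite (UNIV :: 'a set)" and "subspace S" and "finite S"
  shows "card S = card (UNIV :: 'a set) ^ dim S"
proof -
  obtain B where B: "B \<subseteq> S" "independent B" "S \<subseteq> span B" "card B = dim S"
    using basis_exists[of S] by blast
  have "span B = S"
    using B assms(2) by (intro span_subspace) auto
  with B card_span_independent[OF assms(1) finite_subset[OF B(1) assms(3)]] show ?thesis
    by auto
qed

text \<open>The addition map on \<open>A \<times> B\<close> has image \<open>A + B\<close>, and each
  of its fibres is a copy of \<open>A \<inter> B\<close>. This is the dimension formula for sums in
  multiplicative form.\<close>

lemma (in vector_space) card_subspace_sum:
  assumes A: "subspace A" "finite A" and B: "subspace B" "finite B"
  shows "card (span (A \<union> B)) * card (A \<inter> B) = card A * card B"
proof -
  let ?f = "\<lambda>(x, y). x + y"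
  have eq: "span (A \<union> B) = ?f ` (A \<times> B)"
    using A(1) B(1) by (subst span_Un) (auto simp: span_eq_iff[THEN iffD2])
  have fib: "card {p \<in> A \<times> B. ?f p = z} = card (A \<inter> B)" if z: "z \<in> span (A \<union> B)" for z
  proof -
    obtain a b where ab: "a \<in> A" "b \<in> B" "z = a + b"
      using z eq by auto
    \<comment> \<open>Two ways of writing \<open>z\<close> differ by moving a common vector
      \<open>w\<close> from one summand to the other.\<close>
    have "{p \<in> A \<times> B. ?f p = z} = (\<lambda>w. (a + w, b - w)) ` (A \<inter> B)"
    proof (intro equalityI subsetI)
      fix p assume "p \<in> {p \<in> A \<times> B. ?f p = z}"
      then obtain x y where p: "p = (x, y)" "x \<in> A" "y \<in> B" "x + y = a + b"
        using ab by auto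
      have "x - a \<in> A" "b - y \<in> B"
        using p ab A B by (auto intro: subspace_diff)
      moreover have "b - y = x - a" "y = b - (x - a)"
        using p(4) by (simp_all add: algebra_simps)
      ultimately show "p \<in> (\<lambda>w. (a + w, b - w)) ` (A \<inter> B)"
        unfolding p(1) by (intro image_eqI[of _ _ "x - a"]) auto
    next
      fix p assume "p \<in> (\<lambda>w. (a + w, b - w)) ` (A \<inter> B)"
      then show "p \<in> {p \<in> A \<times> B. ?f p = z}"
        using ab A B by (auto intro: subspace_diff subspace_add)
    qed
    then show ?thesis
      by (simp add: card_image inj_on_def)
  qed
  have fin: "finite (span (A \<union> B))"
    unfolding eq using A B by simp
  have "A \<times> B = (\<Union>z\<in>span (A \<union> B). {p \<in> A \<times> B. ?f p = z})"
    using eq by auto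
  then have "card (A \<times> B) = card (\<Union>z\<in>span (A \<union> B). {p \<in> A \<times> B. ?f p = z})"
    by simp
  also have "\<dots> = (\<Sum>z\<in>span (A \<union> B). card {p \<in> A \<times> B. ?f p = z})"
    using fin A B by (intro card_UN_disjoint) auto
  also have "\<dots> = card (span (A \<union> B)) * card (A \<inter> B)"
    using fib by simp
  finally show ?thesis
    by (simp add: card_cartesian_product)
qed

section \<open>Coordinate spaces and their subspaces as finite sets\<close>

lemma one_less_card_UNIV_field: "1 < card (UNIV :: 'a::{field,finite} set)"
proof -
  have "card {0, 1 :: 'a} \<le> card (UNIV :: 'a set)"
    by (intro card_mono) auto
  then show ?thesis by simp
qed

lemma subspace_coord_space [simp]: "fn.subspace (coord_space n)"
  by (auto simp: fn.subspace_def coord_space_def fscale_def)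

lemma card_coord_space:
  "finite (coord_space n :: (nat \<Rightarrow> 'a::{field,finite}) set)"
  "card (coord_space n :: (nat \<Rightarrow> 'a) set) = card (UNIV :: 'a set) ^ n"
proof -
  have "bij_betw (\<lambda>f i. if i < n then f i else 0) ({..<n} \<rightarrow>\<^sub>E (UNIV :: 'a set)) (coord_space n)"
    by (rule bij_betwI[where g = "\<lambda>v. restrict v {..<n}"])
      (auto simp: coord_space_def fun_eq_iff PiE_def extensional_def)
  then show "finite (coord_space n :: (nat \<Rightarrow> 'a) set)"
    "card (coord_space n :: (nat \<Rightarrow> 'a) set) = card (UNIV :: 'a set) ^ n"
    by (auto simp: bij_betw_finite[symmetric] bij_betw_same_card[symmetric] finite_PiE card_PiE)
qed

text \<open>Since \<open>q > 1\<close>, the number \<open>q ^ k\<close> determines \<open>k\<close>,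
  so inside \<open>coord_space n\<close> a dimension is recognised by counting.\<close>

lemma kspaces_iff_card:
  fixes S :: "(nat \<Rightarrow> 'a::{field,finite}) set"
  shows "S \<in> kspaces n k \<longleftrightarrow>
    S \<subseteq> coord_space n \<and> fn.subspace S \<and> card S = card (UNIV :: 'a set) ^ k"
proof -
  have "card S = card (UNIV :: 'a set) ^ fn.dim S" if "S \<subseteq> coord_space n" "fn.subspace S"
    using fn.card_subspace[OF finite that(2)] finite_subset[OF that(1) card_coord_space(1)] by simp
  then show ?thesis
    using one_less_card_UNIV_field[where 'a = 'a] by (auto simp: kspaces_def)
qed

lemma finite_in_kspaces:
  fixes S :: "(nat \<Rightarrow> 'a::{field,finite}) set"
  shows "S \<in> kspaces n k \<Longrightarrow> finite S"
  by (auto simp: kspaces_def intro: finite_subset[OF _ card_coord_space(1)])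

lemma finite_kspaces: "finite (kspaces n k :: (nat \<Rightarrow> 'a::{field,finite}) set set)"
  by (rule finite_subset[of _ "Pow (coord_space n)"])
    (auto simp: kspaces_def card_coord_space)

section \<open>The upper bound\<close>

lemma qint_mono: "1 < q \<Longrightarrow> m \<le> n \<Longrightarrow> qint q m \<le> qint q n"
  unfolding qint_def by (intro divide_right_mono diff_right_mono power_increasing) auto

lemma qint_nonneg: "1 < q \<Longrightarrow> 0 \<le> qint q m"
  unfolding qint_def by (intro divide_nonneg_nonneg) auto

text \<open>The extensions correspond to the lines of the quotient \<open>U / W\<close>, which has
  dimension \<open>m\<close>. With \<open>W\<close> removed they partition \<open>U - W\<close> into
  classes of \<open>q ^ (w + 1) - q ^ w\<close> vectors.\<close>

lemma card_one_step_extensions: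
  fixes W U :: "(nat \<Rightarrow> 'a::{field,finite}) set"
  defines "q \<equiv> card (UNIV :: 'a set)"
  assumes W: "fn.subspace W" "card W = q ^ w" and U: "fn.subspace U" "finite U" "card U = q ^ (w + m)"
    and "W \<subseteq> U"
  shows "real (card ((\<lambda>u. fn.span (insert u W)) ` (U - W))) = qint q m"
proof -
  let ?E = "\<lambda>u. fn.span (insert u W)"
  have q: "1 < q" unfolding q_def by (rule one_less_card_UNIV_field)
  have finW: "finite W" using \<open>W \<subseteq> U\<close> U(2) by (rule finite_subset)
  have sW: "fn.span W = W" using W(1) by simp
  have WE: "W \<subseteq> ?E u" for u
    using fn.span_superset[of "insert u W"] by auto
  have EU: "?E u \<subseteq> U" if "u \<in> U" for u
    using that \<open>W \<subseteq> U\<close> U(1) by (intro fn.span_minimal) auto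
  have cE: "card (?E u - W) = q ^ (w + 1) - q ^ w" if "u \<in> U - W" for u
  proof -
    have "card (?E u) = q * q ^ w"
      using fn.card_span_insert(2)[of W u] finW that W sW by (simp add: q_def)
    then show ?thesis
      using card_Diff_subset[OF finW WE] W by simp
  qed
  \<comment> \<open>Exchange: any vector of an extension outside \<open>W\<close> generates that
    extension over \<open>W\<close>. Hence the classes are disjoint.\<close>
  have E_eq: "?E x = ?E u" if "x \<in> ?E u - W" for x u
  proof -
    have "u \<in> ?E x"
      using fn.in_span_insert[of x u W] that sW by auto
    then have "insert u W \<subseteq> ?E x" using WE by auto
    moreover have "insert x W \<subseteq> ?E u" using that WE by auto
    ultimately show ?thesis by (metis fn.span_eq)
  qed
  define \<E> where "\<E> = ?E ` (U - W)"
  have "U - W = (\<Union>Z\<in>\<E>. Z - W)"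
    unfolding \<E>_def using EU by (fastforce intro: fn.span_base)
  then have "card (U - W) = card (\<Union>Z\<in>\<E>. Z - W)"
    by simp
  also have "\<dots> = (\<Sum>Z\<in>\<E>. card (Z - W))"
  proof (rule card_UN_disjoint)
    show "\<forall>Z\<in>\<E>. finite (Z - W)"
      using EU U(2) by (auto simp: \<E>_def dest: finite_subset)
    show "\<forall>Z\<in>\<E>. \<forall>Y\<in>\<E>. Z \<noteq> Y \<longrightarrow> (Z - W) \<inter> (Y - W) = {}"
      using E_eq unfolding \<E>_def by blast
  qed (use U in \<open>auto simp: \<E>_def\<close>)
  also have "\<dots> = card \<E> * (q ^ (w + 1) - q ^ w)"
  proof -
    have "card (Z - W) = q ^ (w + 1) - q ^ w" if "Z \<in> \<E>" for Z
      using that cE unfolding \<E>_def by blast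
    then show ?thesis by simp
  qed
  finally have "q ^ (w + m) - q ^ w = card \<E> * (q ^ (w + 1) - q ^ w)"
    using card_Diff_subset[OF finW \<open>W \<subseteq> U\<close>] U W by simp
  then have "real (q ^ (w + m) - q ^ w) = real (card \<E>) * real (q ^ (w + 1) - q ^ w)"
    by simp
  then have "real q ^ w * (real q ^ m - 1) = real q ^ w * (real (card \<E>) * (real q - 1))"
    using q by (simp add: of_nat_diff power_add algebra_simps)
  then show ?thesis
    unfolding \<E>_def[symmetric] using q
    by (simp only: mult_cancel_left) (simp add: qint_def nonzero_divide_eq_eq nonzero_eq_divide_eq)
qed

text \<open>The induction needs families whose members all contain a fixed \<open>W\<close>. Passing
  to a one-step extension of \<open>W\<close> turns \<open>(w, Suc j)\<close> into
  \<open>(Suc w, j)\<close> and leaves the dimension of the members unchanged.\<close>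

lemma card_sunflower_free_above:
  fixes W :: "(nat \<Rightarrow> 'a::{field,finite}) set"
  defines "q \<equiv> card (UNIV :: 'a set)"
  assumes "s \<ge> 1"
    and "\<F> \<subseteq> kspaces n (w + j)" and "sunflower_free n (w + j) s \<F>"
    and "fn.subspace W" and "card W = q ^ w" and "\<And>S. S \<in> \<F> \<Longrightarrow> W \<subseteq> S"
  shows "real (card \<F>) \<le> (\<Prod>i=1..j. qint q (i * (s - 1)))"
  using assms(3-)
proof (induction j arbitrary: w W \<F>)
  \<comment> \<open>The members have as many vectors as \<open>W\<close>, so \<open>W\<close> is the
    only possible one; the empty product is 1.\<close>
  case 0
  have "S = W" if "S \<in> \<F>" for S
  proof -
    have "finite S" "card S = q ^ w"
      using 0 that finite_in_kspaces[of S n w] by (auto simp: kspaces_iff_card q_def)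
    then show ?thesis
      using 0 that by (metis card_subset_eq)
  qed
  then have "\<F> \<subseteq> {W}" by auto
  then have "card \<F> \<le> card {W}" by (intro card_mono) auto
  then show ?case by simp
next
  case (Suc j)
  have q: "1 < q" unfolding q_def by (rule one_less_card_UNIV_field)
  have finF: "finite \<F>"
    using Suc.prems(1) finite_kspaces by (rule finite_subset)
  have S: "S \<subseteq> coord_space n" "fn.subspace S" "card S = q ^ (w + Suc j)" "finite S" "W \<subseteq> S"
    if "S \<in> \<F>" for S
  proof -
    have "S \<in> kspaces n (w + Suc j)" using that Suc.prems by auto
    then show "S \<subseteq> coord_space n" "fn.subspace S" "card S = q ^ (w + Suc j)" "finite S"
      by (simp_all add: finite_in_kspaces) (simp_all add: kspaces_iff_card q_def)
    show "W \<subseteq> S" using that Suc.prems by simp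
  qed
  show ?case
  proof (cases "\<F> = {}")
    case True
    then show ?thesis using prod_nonneg[of "{1..Suc j}" "\<lambda>i. qint q (i * (s - 1))"] qint_nonneg[OF q]
      by simp
  next
    case False
    \<comment> \<open>A member of the family places \<open>W\<close> inside
      \<open>coord_space n\<close>, as a kernel has to be.\<close>
    then have Wn: "W \<subseteq> coord_space n" using S by blast
    \<comment> \<open>General position modulo \<open>W\<close>. Including \<open>W\<close> in the
      span makes the empty \<open>T\<close> good, with span \<open>W\<close> itself.\<close>
    define good where "good T \<longleftrightarrow> T \<subseteq> \<F> \<and> (\<forall>S\<in>T. \<forall>S'\<in>T. S \<noteq> S' \<longrightarrow> S \<inter> S' = W) \<and>
      card (fn.span (W \<union> \<Union>T)) = q ^ (w + card T * Suc j)" for T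
    have span_sub: "fn.span (W \<union> \<Union>T) \<subseteq> coord_space n" if "T \<subseteq> \<F>" for T
      using that S Wn by (intro fn.span_minimal) auto
    \<comment> \<open>With \<open>s\<close> members, \<open>T\<close> would be a sunflower with
      kernel \<open>W\<close>. As \<open>s \<ge> 1\<close>, some member contains \<open>W\<close>,
      so adding \<open>W\<close> to the union changes nothing.\<close>
    have good_ne: "card T \<noteq> s" if "good T" for T
    proof
      assume cT: "card T = s"
      have TF: "T \<subseteq> \<F>" and meets: "\<forall>S\<in>T. \<forall>S'\<in>T. S \<noteq> S' \<longrightarrow> S \<inter> S' = W"
        and span: "card (fn.span (W \<union> \<Union>T)) = q ^ (w + s * Suc j)"
        using that cT by (auto simp: good_def)
      obtain A where "A \<in> T" using cT assms(2) by (metis card.empty equals0I not_one_le_zero)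
      then have "W \<subseteq> \<Union>T" using S(5) TF by blast
      then have "W \<union> \<Union>T = \<Union>T" by (rule Un_absorb1)
      then have "fn.span (\<Union>T) \<in> kspaces n (w + s * Suc j)"
        using span span_sub[OF TF] by (simp add: kspaces_iff_card q_def)
      then have "fn.dim (fn.span (\<Union>T)) = w + s * (w + Suc j - w)"
        by (simp add: kspaces_def)
      moreover have "W \<in> kspaces n w"
        using Wn Suc.prems by (auto simp: kspaces_iff_card q_def)
      ultimately have "sunflower n (w + Suc j) s T"
        unfolding sunflower_def using TF meets Suc.prems(1) cT finite_subset[OF TF finF] by blast
      with Suc.prems(2) TF show False
        unfolding sunflower_free_def by blast
    qed
    have "good {}"
      using Suc.prems by (simp add: good_def fn.span_eq_iff[THEN iffD2])
    then have ex: "\<exists>T. good T \<and> card T < s" using assms(2) by (intro exI[of _ "{}"]) auto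
    moreover have "\<forall>T. good T \<and> card T < s \<longrightarrow> card T \<le> s" by auto
    ultimately obtain T where T: "good T" "card T < s"
      and Tmax: "\<And>T'. good T' \<Longrightarrow> card T' < s \<Longrightarrow> card T' \<le> card T"
      using ex_has_greatest_nat[of "\<lambda>T. good T \<and> card T < s" _ card s] by blast
    define U where "U = fn.span (W \<union> \<Union>T)"
    have finT: "finite T" using T finF by (auto simp: good_def dest: finite_subset)
    have U: "fn.subspace U" "finite U" "card U = q ^ (w + card T * Suc j)" "W \<subseteq> U"
      using T span_sub[of T] finite_subset[OF _ card_coord_space(1)[where 'a = 'a]]
        fn.span_superset[of "W \<union> \<Union>T"]
      by (auto simp: U_def good_def)
    \<comment> \<open>A member meeting \<open>U\<close> in \<open>W\<close> alone could be added to
      \<open>T\<close>, which would stay good. The larger set would either have \<open>s\<close>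
      members, which is excluded, or contradict the maximality of \<open>T\<close>.\<close>
    have meet: "\<exists>u\<in>U - W. fn.span (insert u W) \<subseteq> A" if A: "A \<in> \<F>" for A
    proof (rule ccontr)
      assume "\<not> ?thesis"
      moreover have "fn.span (insert u W) \<subseteq> A" if "u \<in> A" for u
        using that S[OF A] by (intro fn.span_minimal) auto
      ultimately have AU: "A \<inter> U = W"
        using S(5)[OF A] U(4) by blast
      have UT: "B \<subseteq> U" if "B \<in> T" for B
        using that fn.span_superset[of "W \<union> \<Union>T"] unfolding U_def by blast
      \<comment> \<open>A member of \<open>T\<close> lies in \<open>U\<close>, so it would equal
        \<open>W\<close>, although its codimension over \<open>W\<close> is
        \<open>Suc j\<close>.\<close>
      have "A \<notin> T"
      proof
        assume "A \<in> T"
        then have "A = W" using AU UT[of A] by blast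
        then have "q ^ (w + Suc j) = q ^ w" using S(3)[OF A] Suc.prems(4) by simp
        then show False using q by (simp only: power_inject_exp)
      qed
      then have c: "card (insert A T) = Suc (card T)" using finT by simp
      have "good (insert A T)"
        unfolding good_def
      proof (intro conjI ballI impI)
        show "insert A T \<subseteq> \<F>" using A T by (auto simp: good_def)
      next
        have AB: "A \<inter> B = W" if "B \<in> T" for B
        proof -
          have "W \<subseteq> B" using T(1) that S(5) by (auto simp: good_def)
          then show ?thesis using UT[OF that] AU by blast
        qed
        moreover have "\<forall>S\<in>T. \<forall>S'\<in>T. S \<noteq> S' \<longrightarrow> S \<inter> S' = W"
          using T(1) by (simp add: good_def)
        ultimately show "Z \<inter> Y = W" if "Z \<in> insert A T" "Y \<in> insert A T" "Z \<noteq> Y" for Z Y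
          using that by (metis Int_commute insert_iff)
      next
        have "fn.span (W \<union> \<Union>(insert A T)) = fn.span (U \<union> A)"
        proof (intro fn.span_eq[THEN iffD2] conjI)
          have "U \<subseteq> fn.span (W \<union> \<Union>(insert A T))"
            unfolding U_def by (intro fn.span_mono) auto
          then show "U \<union> A \<subseteq> fn.span (W \<union> \<Union>(insert A T))"
            using fn.span_superset[of "W \<union> \<Union>(insert A T)"] by auto
          show "W \<union> \<Union>(insert A T) \<subseteq> fn.span (U \<union> A)"
            using fn.span_superset[of "U \<union> A"] UT U(4) by blast
        qed
        \<comment> \<open>The dimension formula for \<open>U\<close> and \<open>A\<close>, which
          meet in \<open>W\<close>: the dimension grows by exactly \<open>Suc j\<close>.\<close>
        moreover have "card (fn.span (U \<union> A)) * q ^ w = q ^ (w + card T * Suc j) * q ^ (w + Suc j)"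
          using fn.card_subspace_sum[of U A] U S[OF A] AU Suc.prems by (simp add: Int_commute)
        then have "card (fn.span (U \<union> A)) * q ^ w = q ^ (w + card (insert A T) * Suc j) * q ^ w"
          unfolding c by (simp add: power_add algebra_simps)
        ultimately show "card (fn.span (W \<union> \<Union>(insert A T))) = q ^ (w + card (insert A T) * Suc j)"
          using q by simp
      qed
      with T c good_ne[OF this] Tmax[OF this] show False by auto
    qed
    define E where "E = (\<lambda>u. fn.span (insert u W)) ` (U - W)"
    have finE: "finite E" unfolding E_def using U by simp
    \<comment> \<open>By \<open>meet\<close>, the family is covered by the subfamilies above the
      extensions \<open>Z\<close>, and the induction hypothesis bounds each of them.\<close>
    have "card \<F> \<le> card (\<Union>Z\<in>E. {A \<in> \<F>. Z \<subseteq> A})"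
      using meet U(2) finF by (intro card_mono) (auto simp: E_def)
    also have "\<dots> \<le> (\<Sum>Z\<in>E. card {A \<in> \<F>. Z \<subseteq> A})"
      using finE by (rule card_UN_le)
    finally have "real (card \<F>) \<le> (\<Sum>Z\<in>E. real (card {A \<in> \<F>. Z \<subseteq> A}))"
      by (simp flip: of_nat_sum)
    also have "\<dots> \<le> (\<Sum>Z\<in>E. \<Prod>i=1..j. qint q (i * (s - 1)))"
    proof (intro sum_mono)
      fix Z assume "Z \<in> E"
      then obtain u where u: "u \<in> U - W" "Z = fn.span (insert u W)" by (auto simp: E_def)
      have sW: "fn.span W = W" using Suc.prems by simp
      have cZ: "card Z = q ^ Suc w"
        using fn.card_span_insert(2)[of W u] u U(2) finite_subset[OF U(4)] sW Suc.prems(4)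
        by (simp add: q_def)
      show "real (card {A \<in> \<F>. Z \<subseteq> A}) \<le> (\<Prod>i=1..j. qint q (i * (s - 1)))"
      proof (rule Suc.IH)
        show "{A \<in> \<F>. Z \<subseteq> A} \<subseteq> kspaces n (Suc w + j)" using Suc.prems(1) by auto
        show "sunflower_free n (Suc w + j) s {A \<in> \<F>. Z \<subseteq> A}"
          using Suc.prems(2) unfolding sunflower_free_def by auto
      qed (use u cZ in auto)
    qed
    also have "\<dots> = real (card E) * (\<Prod>i=1..j. qint q (i * (s - 1)))" by simp
    also have "real (card E) = qint q (card T * Suc j)"
      unfolding E_def q_def
      by (rule card_one_step_extensions) (use Suc.prems U in \<open>auto simp: q_def\<close>)
    also have "\<dots> * (\<Prod>i=1..j. qint q (i * (s - 1))) \<le> qint q (Suc j * (s - 1)) * (\<Prod>i=1..j. qint q (i * (s - 1)))"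
    proof (intro mult_right_mono qint_mono prod_nonneg qint_nonneg ballI q)
      have "card T \<le> s - 1" using T by simp
      then show "card T * Suc j \<le> Suc j * (s - 1)"
        using mult_le_mono1 by (metis mult.commute)
    qed
    also have "\<dots> = (\<Prod>i=1..Suc j. qint q (i * (s - 1)))" by simp
    finally show ?thesis .
  qed
qed

text \<open>The case \<open>W = {0}\<close>, in which the codimension is the whole of
  \<open>k\<close>.\<close>

lemma card_sunflower_free_le:
  fixes \<F> :: "(nat \<Rightarrow> 'a::{field,finite}) set set"
  assumes "s \<ge> 1" and "\<F> \<subseteq> kspaces n k" and "sunflower_free n k s \<F>"
  shows "real (card \<F>) \<le> (\<Prod>i=1..k. qint (card (UNIV :: 'a set)) (i * (s - 1)))"
  using card_sunflower_free_above[of s \<F> n 0 k "{0}"] assms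
  by (auto simp: kspaces_def intro: fn.subspace_0)

text \<open>Each factor \<open>qint q m\<close> is at most \<open>q / (q - 1)\<close> times
  \<open>q ^ (m - 1)\<close>. The exponents \<open>i * (s - 1) - 1\<close> for
  \<open>i = 1, ..., k\<close> add up to the one stated.\<close>

lemma prod_qint_le:
  assumes "1 < q" and "s \<ge> 2"
  shows "(\<Prod>i=1..k. qint q (i * (s - 1))) \<le>
    (real q / (real q - 1)) ^ k * real q powr ((real s - 1) * real ((k + 1) choose 2) - real k)"
proof (induction k)
  case (Suc k)
  let ?m = "Suc k * (s - 1)"
  have "qint q ?m \<le> real q ^ ?m / (real q - 1)"
    unfolding qint_def using assms by (intro divide_right_mono) auto
  also have "real q ^ ?m = real q * real q powr (real ?m - 1)"
    using assms by (simp add: powr_diff powr_realpow del: of_nat_mult mult_Suc)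
  also have "\<dots> / (real q - 1) = real q / (real q - 1) * real q powr (real ?m - 1)"
    by simp
  finally have *: "qint q ?m \<le> real q / (real q - 1) * real q powr (real ?m - 1)" .
  have m: "real ?m = (real k + 1) * (real s - 1)"
    using assms by (simp only: of_nat_mult of_nat_diff) (simp add: algebra_simps)
  have c: "(Suc k + 1) choose 2 = ((k + 1) choose 2) + Suc k"
    by (simp add: numeral_2_eq_2)
  have "(\<Prod>i=1..Suc k. qint q (i * (s - 1))) = (\<Prod>i=1..k. qint q (i * (s - 1))) * qint q ?m"
    by simp
  also have "\<dots> \<le> ((real q / (real q - 1)) ^ k * real q powr ((real s - 1) * real ((k + 1) choose 2) - real k))
      * (real q / (real q - 1) * real q powr (real ?m - 1))"
    using assms by (intro mult_mono Suc.IH * mult_nonneg_nonneg zero_le_power qint_nonneg) auto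
  also have "\<dots> = (real q / (real q - 1)) ^ Suc k *
      (real q powr ((real s - 1) * real ((k + 1) choose 2) - real k) * real q powr (real ?m - 1))"
    by (simp add: algebra_simps)
  also have "real q powr ((real s - 1) * real ((k + 1) choose 2) - real k) * real q powr (real ?m - 1)
      = real q powr ((real s - 1) * real ((Suc k + 1) choose 2) - real (Suc k))"
    unfolding c m powr_add[symmetric] by (intro arg_cong2[of _ _ _ _ "(powr)"] refl)
      (simp add: algebra_simps)
  finally show ?case .
qed (use assms in \<open>simp add: numeral_2_eq_2\<close>)

section \<open>Gabidulin codes\<close>

lemma field_power_card:
  fixes x :: "'a::{field,finite}"
  shows "x ^ card (UNIV :: 'a set) = x"
proof (cases "x = 0")
  case True
  then show ?thesis using one_less_card_UNIV_field[where 'a = 'a] by (simp add: zero_power)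
next
  case False
  let ?P = "\<Prod>y\<in>UNIV - {0 :: 'a}. y"
  have P0: "?P \<noteq> 0" by simp
  \<comment> \<open>Multiplication by \<open>x\<close> permutes the nonzero elements, so their
    product is unchanged and \<open>x ^ (q - 1) = 1\<close>.\<close>
  have "bij_betw ((*) x) (UNIV - {0}) (UNIV - {0})"
    by (rule bij_betwI[where g = "\<lambda>y. y / x"]) (use False in auto)
  then have "?P = (\<Prod>y\<in>UNIV - {0 :: 'a}. x * y)"
    by (rule prod.reindex_bij_betw[symmetric])
  also have "\<dots> = x ^ card (UNIV - {0 :: 'a}) * ?P"
    by (simp add: prod.distrib)
  finally have "x ^ card (UNIV - {0 :: 'a}) = 1"
    using P0 by simp
  moreover have "card (UNIV :: 'a set) = Suc (card (UNIV - {0 :: 'a}))"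
    by (rule card_Suc_Diff1[symmetric]) auto
  ultimately show ?thesis by (simp only: power_Suc mult_1_right)
qed

text \<open>The polynomial \<open>(X + 1)\<^sup>q - X\<^sup>q - 1\<close> has degree less than \<open>q\<close> but vanishes at all \<open>q\<close>
  elements of the field.\<close>
lemma of_nat_card_choose:
  assumes "0 < i" and "i < card (UNIV :: 'a::{field,finite} set)"
  shows "(of_nat (card (UNIV :: 'a set) choose i) :: 'a) = 0"
proof -
  define q where "q = card (UNIV :: 'a set)"
  have q: "1 < q" unfolding q_def by (rule one_less_card_UNIV_field)
  define p where "p = (\<Sum>j\<in>{1..<q}. monom (of_nat (q choose j) :: 'a) j)"
  have "poly p x = 0" for x
  proof -
    have set: "{..q} = insert 0 (insert q {1..<q})" using q by auto
    have "x + 1 = (x + 1) ^ q" by (simp add: q_def field_power_card)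
    also have "\<dots> = (\<Sum>j\<le>q. of_nat (q choose j) * x ^ j)"
      by (subst binomial_ring) simp
    also have "\<dots> = 1 + x ^ q + poly p x"
      unfolding set p_def using q by (simp add: poly_sum poly_monom)
    finally show ?thesis by (simp add: q_def field_power_card)
  qed
  then have roots: "{x. poly p x = 0} = UNIV" by auto
  have "p = 0"
  proof (rule ccontr)
    assume "p \<noteq> 0"
    then have "q \<le> degree p"
      using card_poly_roots_bound[of p] roots by (simp add: q_def)
    moreover have "degree p \<le> q - 1"
      unfolding p_def by (intro degree_sum_le) (auto intro: order.trans[OF degree_monom_le])
    ultimately show False using q by simp
  qed
  moreover have "coeff p i = of_nat (q choose i)"
    unfolding p_def using assms by (simp add: coeff_sum q_def)
  ultimately show ?thesis by (simp add: q_def)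
qed

text \<open>The inner binomial coefficients vanish in the finite field, hence also in its closure.
  Working with \<open>q\<close> itself keeps the characteristic out of the argument.\<close>

lemma alg_closure_frobenius_add:
  fixes x y :: "'a::{field,finite} alg_closure"
  shows "(x + y) ^ card (UNIV :: 'a set) = x ^ card (UNIV :: 'a set) + y ^ card (UNIV :: 'a set)"
proof -
  define q where "q = card (UNIV :: 'a set)"
  have q: "1 < q" unfolding q_def by (rule one_less_card_UNIV_field)
  have z: "(of_nat (q choose i) :: 'a alg_closure) = 0" if "0 < i" "i < q" for i
    using of_nat_card_choose[where 'a = 'a, of i] that
    by (metis q_def to_ac_0 to_ac_of_nat)
  have set: "{..q} = insert 0 (insert q {1..<q})" using q by auto
  have "(x + y) ^ q = (\<Sum>j\<le>q. of_nat (q choose j) * x ^ j * y ^ (q - j))"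
    by (rule binomial_ring)
  also have "\<dots> = x ^ q + y ^ q"
    unfolding set using q z by simp
  finally show ?thesis unfolding q_def .
qed

lemma alg_closure_frobenius_power_add:
  fixes x y :: "'a::{field,finite} alg_closure"
  shows "(x + y) ^ (card (UNIV :: 'a set) ^ i) =
    x ^ (card (UNIV :: 'a set) ^ i) + y ^ (card (UNIV :: 'a set) ^ i)"
proof (induction i)
  case (Suc i)
  then show ?case
    by (simp add: power_mult mult.commute[of "card (UNIV :: 'a set)"] alg_closure_frobenius_add)
qed simp

text \<open>Frobenius powers fix the base field; this later makes the Gabidulin maps linear over
  it.\<close>

lemma to_ac_power_card_power: "to_ac (c :: 'a::{field,finite}) ^ (card (UNIV :: 'a set) ^ i) = to_ac c"
proof (induction i)
  case (Suc i)
  then show ?case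
    by (simp add: power_mult mult.commute[of "card (UNIV :: 'a set)"] field_power_card flip: to_ac_power)
qed simp

text \<open>For \<open>w > 0\<close>, the copy of the field with \<open>q ^ w\<close> elements in
  the algebraic closure, as the roots of \<open>X ^ (q ^ w) - X\<close>.\<close>

definition ac_subfield :: "nat \<Rightarrow> 'a::{field,finite} alg_closure set" where
  "ac_subfield w = {x. x ^ (card (UNIV :: 'a set) ^ w) = x}"

text \<open>With \<open>Q = q ^ w\<close>, the polynomial \<open>X ^ Q - X\<close> splits into
  linear factors and has derivative \<open>-1\<close>, because \<open>Q\<close> is zero in the
  field. So its \<open>Q\<close> roots are distinct.\<close>

lemma card_ac_subfield:
  assumes "0 < w"
  shows "finite (ac_subfield w :: 'a::{field,finite} alg_closure set)"
    and "card (ac_subfield w :: 'a alg_closure set) = card (UNIV :: 'a set) ^ w"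
proof -
  define Q where "Q = card (UNIV :: 'a set) ^ w"
  have Q: "1 < Q" unfolding Q_def using one_less_card_UNIV_field assms by (intro one_less_power)
  define p where "p = monom 1 Q + [:0, -1 :: 'a alg_closure:]"
  have deg: "degree p = Q"
    unfolding p_def using Q by (subst degree_add_eq_left) (auto simp: degree_monom_eq)
  then have p0: "p \<noteq> 0" using Q by auto
  have L: "ac_subfield w = {x. poly p x = 0}"
    by (auto simp: ac_subfield_def p_def poly_monom Q_def)
  show fin: "finite (ac_subfield w :: 'a alg_closure set)"
    unfolding L using p0 by (rule poly_roots_finite)
  \<comment> \<open>\<open>q\<close> is the binomial coefficient \<open>q choose 1\<close>, so it
    vanishes in the field; so does its power \<open>Q\<close>, as \<open>w > 0\<close>.\<close>
  have "(of_nat (card (UNIV :: 'a set)) :: 'a) = 0"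
    using of_nat_card_choose[where 'a = 'a, of 1] one_less_card_UNIV_field[where 'a = 'a] by simp
  then have "(of_nat Q :: 'a alg_closure) = 0"
    unfolding Q_def using assms by (metis of_nat_power power_0_left to_ac_0 to_ac_of_nat not_gr0)
  then have pd: "pderiv p = [:-1:]"
    by (simp add: p_def pderiv_add pderiv_monom pderiv_pCons)
  obtain A c where A: "size A = degree p" "p = smult c (\<Prod>x\<in>#A. [:-x, 1:])" and c: "c \<noteq> 0"
    using alg_closed_imp_factorization[OF p0] p0 by (metis leading_coeff_0_iff)
  \<comment> \<open>A repeated root would also be a root of the derivative, which is the constant
    \<open>-1\<close>.\<close>
  have c1: "count A x = 1" if "x \<in># A" for x
  proof (rule ccontr)
    assume "count A x \<noteq> 1"
    then have "1 < count A x" using that by (simp add: count_greater_zero_iff[symmetric] del: count_greater_zero_iff)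
    then have "x \<in># A - {#x#}" by (simp add: in_diff_count)
    then have "A = add_mset x (add_mset x (A - {#x#} - {#x#}))"
      by (simp only: insert_DiffM that)
    then obtain A' where "A = add_mset x (add_mset x A')" ..
    then have r: "p = smult c ([:-x, 1:] * ([:-x, 1:] * (\<Prod>x\<in>#A'. [:-x, 1:])))"
      using A(2) by (simp only: image_mset_add_mset prod_mset.add_mset)
    have "poly (pderiv p) x = 0"
      unfolding r by (simp only: pderiv_smult pderiv_mult poly_smult poly_add poly_mult) simp
    then show False by (simp add: pd)
  qed
  have set_A: "set_mset A = ac_subfield w"
  proof -
    have "poly p x = 0 \<longleftrightarrow> x \<in># A" for x
      unfolding A(2) using c by (auto simp: poly_prod_mset)
    then show ?thesis unfolding L by auto
  qed
  have "Q = (\<Sum>x\<in>set_mset A. count A x)"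
    unfolding deg[symmetric] A(1)[symmetric] by (rule size_multiset_overloaded_eq)
  also have "\<dots> = (\<Sum>x\<in>set_mset A. 1)" by (intro sum.cong refl c1)
  also have "\<dots> = card (ac_subfield w :: 'a alg_closure set)" unfolding set_A by simp
  finally show "card (ac_subfield w :: 'a alg_closure set) = card (UNIV :: 'a set) ^ w"
    by (simp add: Q_def)
qed

interpretation ac: vector_space "\<lambda>c x. to_ac c * x :: 'a::field alg_closure"
  by unfold_locales (auto simp: algebra_simps)

lemma ac_subfield_closed:
  fixes x y :: "'a::{field,finite} alg_closure"
  shows "x \<in> ac_subfield w \<Longrightarrow> y \<in> ac_subfield w \<Longrightarrow> x + y \<in> ac_subfield w"
    and "x \<in> ac_subfield w \<Longrightarrow> y \<in> ac_subfield w \<Longrightarrow> x * y \<in> ac_subfield w"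
    and "x \<in> ac_subfield w \<Longrightarrow> x ^ n \<in> ac_subfield w"
    and "(0 :: 'a alg_closure) \<in> ac_subfield w" and "to_ac (c :: 'a) \<in> ac_subfield w"
proof -
  show "x \<in> ac_subfield w \<Longrightarrow> y \<in> ac_subfield w \<Longrightarrow> x + y \<in> ac_subfield w"
    by (simp add: ac_subfield_def alg_closure_frobenius_power_add)
  show "x \<in> ac_subfield w \<Longrightarrow> y \<in> ac_subfield w \<Longrightarrow> x * y \<in> ac_subfield w"
    by (simp add: ac_subfield_def power_mult_distrib)
  show "x \<in> ac_subfield w \<Longrightarrow> x ^ n \<in> ac_subfield w"
    by (simp add: ac_subfield_def power_commutes power_mult[symmetric] mult.commute[of n])
      (simp add: power_mult)
  show "(0 :: 'a alg_closure) \<in> ac_subfield w" "to_ac c \<in> ac_subfield w"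
    using one_less_card_UNIV_field[where 'a = 'a]
    by (simp_all add: ac_subfield_def to_ac_power_card_power zero_power)
qed

lemma subspace_ac_subfield: "ac.subspace (ac_subfield w :: 'a::{field,finite} alg_closure set)"
  by (intro ac.subspaceI) (simp_all add: ac_subfield_closed)

section \<open>Coordinates on the subfield and the Gabidulin maps\<close>

abbreviation fn_linear :: "((nat \<Rightarrow> 'a::field) \<Rightarrow> nat \<Rightarrow> 'a) \<Rightarrow> bool" where
  "fn_linear \<equiv> Vector_Spaces.linear fscale fscale"

lemma fn_linear_iff:
  "fn_linear f \<longleftrightarrow> (\<forall>x y. f (x + y) = f x + f y) \<and> (\<forall>c x. f (fscale c x) = fscale c (f x))"
  by (simp add: Vector_Spaces.linear_iff fn.vector_space_axioms)

text \<open>Identifies \<open>coord_space w\<close> with the field of \<open>q ^ w\<close> elements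
  through a basis over the base field; counting shows that such a basis has \<open>w\<close>
  elements.\<close>

lemma ac_subfield_coordinates:
  assumes "0 < w"
  obtains \<phi> :: "(nat \<Rightarrow> 'a::{field,finite}) \<Rightarrow> 'a alg_closure"
  where "\<And>x y. \<phi> (x + y) = \<phi> x + \<phi> y" and "\<And>c x. \<phi> (fscale c x) = to_ac c * \<phi> x"
    and "range \<phi> \<subseteq> ac_subfield w" and "bij_betw \<phi> (coord_space w) (ac_subfield w)"
proof -
  let ?L = "ac_subfield w :: 'a alg_closure set"
  obtain B where B: "B \<subseteq> ?L" "ac.independent B" "?L \<subseteq> ac.span B" "card B = ac.dim ?L"
    using ac.basis_exists[of ?L] by blast
  have finB: "finite B" using B(1) card_ac_subfield(1)[OF assms] by (rule finite_subset)
  have "card B = w"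
    using ac.card_subspace[OF finite subspace_ac_subfield card_ac_subfield(1)[OF assms]]
      card_ac_subfield(2)[OF assms, where 'a = 'a] B(4) one_less_card_UNIV_field[where 'a = 'a]
    by (metis power_inject_exp)
  then obtain b where b: "bij_betw b {..<w} B"
    using ex_bij_betw_nat_finite[OF finB] by (auto simp: atLeast0LessThan)
  \<comment> \<open>Only coordinates below \<open>w\<close> are read, so \<open>\<phi>\<close> is
    linear on all vectors and injective on \<open>coord_space w\<close>.\<close>
  define \<phi> where "\<phi> v = (\<Sum>i<w. to_ac (v i) * b i)" for v :: "nat \<Rightarrow> 'a"
  have add: "\<phi> (x + y) = \<phi> x + \<phi> y" for x y
    by (simp add: \<phi>_def algebra_simps sum.distrib)
  have scale: "\<phi> (fscale c x) = to_ac c * \<phi> x" for c x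
    by (simp add: \<phi>_def fscale_def algebra_simps sum_distrib_left)
  have ran: "range \<phi> \<subseteq> ?L"
  proof safe
    fix v
    show "\<phi> v \<in> ?L" unfolding \<phi>_def
      using b B(1) by (intro ac.subspace_sum subspace_ac_subfield ac.subspace_scale)
        (auto simp: bij_betw_def)
  qed
  have inj: "inj_on \<phi> (coord_space w)"
  proof (rule inj_onI)
    fix x y :: "nat \<Rightarrow> 'a"
    assume x: "x \<in> coord_space w" and y: "y \<in> coord_space w" and e: "\<phi> x = \<phi> y"
    have "(\<Sum>u\<in>B. to_ac ((x - y) (inv_into {..<w} b u)) * u) = (\<Sum>i<w. to_ac ((x - y) i) * b i)"
      using b by (subst sum.reindex_bij_betw[OF b, symmetric])
        (auto intro!: sum.cong simp: bij_betw_inv_into_left)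
    also have "\<dots> = \<phi> x - \<phi> y"
      by (simp add: \<phi>_def algebra_simps sum_subtractf)
    finally have "(\<Sum>u\<in>B. to_ac ((x - y) (inv_into {..<w} b u)) * u) = 0"
      using e by simp
    from ac.independentD[OF B(2) finB subset_refl this]
    have "(x - y) (inv_into {..<w} b u) = 0" if "u \<in> B" for u
      using that .
    then have "(x - y) i = 0" if "i < w" for i
      using b that by (metis bij_betw_apply bij_betw_inv_into_left lessThan_iff)
    then show "x = y"
      using x y by (auto simp: fun_eq_iff coord_space_def) (metis not_le)
  qed
  have "\<phi> ` coord_space w = ?L"
    using ran inj card_ac_subfield[OF assms, where 'a = 'a]
    by (intro card_subset_eq) (auto simp: card_image card_coord_space)
  with that[OF add scale ran] inj show thesis by (auto simp: bij_betw_def)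
qed

text \<open>Gabidulin's construction: the maps \<open>x \<mapsto> \<Sum>i<e. a\<^sub>i x\<^bsup>q\<^sup>i\<^esup>\<close> on the field with \<open>q\<^sup>w\<close> elements.
  A nonzero one has at most \<open>q\<^bsup>e-1\<^esup>\<close> zeros, for degree reasons.\<close>
lemma gabidulin_code:
  assumes "0 < e" and "e \<le> k" and "k \<le> w"
  obtains C :: "((nat \<Rightarrow> 'a::{field,finite}) \<Rightarrow> nat \<Rightarrow> 'a) set"
  where "finite C" and "card C = card (UNIV :: 'a set) ^ (w * e)"
    and "\<And>f. f \<in> C \<Longrightarrow> fn_linear f"
    and "\<And>f v. f \<in> C \<Longrightarrow> f v \<in> coord_space w"
    and "\<And>f g Y. f \<in> C \<Longrightarrow> g \<in> C \<Longrightarrow> Y \<subseteq> coord_space k \<Longrightarrow>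
      card Y \<ge> card (UNIV :: 'a set) ^ e \<Longrightarrow> (\<And>y. y \<in> Y \<Longrightarrow> f y = g y) \<Longrightarrow> f = g"
proof -
  define q where "q = card (UNIV :: 'a set)"
  have q: "1 < q" unfolding q_def by (rule one_less_card_UNIV_field)
  let ?L = "ac_subfield w :: 'a alg_closure set"
  have w: "0 < w" using assms by simp
  obtain \<phi> :: "(nat \<Rightarrow> 'a) \<Rightarrow> 'a alg_closure"
    where add: "\<And>x y. \<phi> (x + y) = \<phi> x + \<phi> y" and scale: "\<And>c x. \<phi> (fscale c x) = to_ac c * \<phi> x"
      and ran: "range \<phi> \<subseteq> ?L" and bij: "bij_betw \<phi> (coord_space w) ?L"
    using ac_subfield_coordinates[OF w] by metis
  define \<psi> where "\<psi> = inv_into (coord_space w) \<phi>"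
  have \<psi>: "\<psi> z \<in> coord_space w" "\<phi> (\<psi> z) = z" if "z \<in> ?L" for z
    using that bij unfolding \<psi>_def by (auto simp: bij_betw_def inv_into_into f_inv_into_f)
  have \<phi>_inj: "x = y" if "x \<in> coord_space w" "y \<in> coord_space w" "\<phi> x = \<phi> y" for x y
    using that bij by (auto simp: bij_betw_def dest: inj_onD)
  define P where "P a x = (\<Sum>i<e. a i * x ^ (q ^ i))" for a :: "nat \<Rightarrow> 'a alg_closure" and x
  define A where "A = ({..<e} \<rightarrow>\<^sub>E ?L)"
  have P_L: "P a x \<in> ?L" if "a \<in> A" "x \<in> ?L" for a x
    unfolding P_def
  proof (intro ac.subspace_sum subspace_ac_subfield ac_subfield_closed(2,3))
    fix i assume "i \<in> {..<e}"
    then show "a i \<in> ?L" using that by (auto simp: A_def)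
  qed (use that in auto)
  define F where "F a v = \<psi> (P a (\<phi> v))" for a v
  have F_co: "F a v \<in> coord_space w" and \<phi>F: "\<phi> (F a v) = P a (\<phi> v)" if "a \<in> A" for a v
    using \<psi>[OF P_L[OF that, of "\<phi> v"]] ran unfolding F_def by auto
  \<comment> \<open>Agreement on \<open>Y\<close> gives a polynomial \<open>p\<close> with at least
    \<open>q ^ e\<close> roots; its degree would be at most \<open>q ^ (e - 1)\<close>, so
    \<open>p = 0\<close>. Distinct points of \<open>Y\<close> give distinct roots because
    \<open>k \<le> w\<close>.\<close>
  have uniq: "a = a'"
    if a: "a \<in> A" "a' \<in> A" and Y: "Y \<subseteq> coord_space k" "card Y \<ge> q ^ e" and eq: "\<And>y. y \<in> Y \<Longrightarrow> F a y = F a' y"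
    for a a' Y
  proof -
    define p where "p = (\<Sum>i<e. monom (a i - a' i) (q ^ i))"
    have Yw: "Y \<subseteq> coord_space w" using Y(1) assms(3) by (auto simp: coord_space_def)
    have "p = 0"
    proof (rule ccontr)
      assume p0: "p \<noteq> 0"
      have "poly p (\<phi> y) = 0" if "y \<in> Y" for y
      proof -
        have "P a (\<phi> y) = P a' (\<phi> y)" using eq[OF that] \<phi>F a by metis
        then show ?thesis
          by (simp add: p_def P_def poly_sum poly_monom algebra_simps sum_subtractf)
      qed
      then have sub: "\<phi> ` Y \<subseteq> {x. poly p x = 0}" by auto
      have "inj_on \<phi> Y" using \<phi>_inj Yw by (auto simp: inj_on_def)
      then have "q ^ e \<le> card (\<phi> ` Y)" using Y(2) by (simp add: card_image)
      also have "\<dots> \<le> card {x. poly p x = 0}" using sub p0 by (intro card_mono poly_roots_finite)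
      also have "\<dots> \<le> degree p" using p0 by (rule card_poly_roots_bound)
      also have "\<dots> \<le> q ^ (e - 1)"
        unfolding p_def using q
        by (intro degree_sum_le) (auto intro!: order.trans[OF degree_monom_le] power_increasing)
      also have "\<dots> < q ^ e" using q assms(1) by (intro power_strict_increasing) auto
      finally show False by simp
    qed
    have "a i = a' i" if "i < e" for i
    proof -
      have "coeff p (q ^ i) = (\<Sum>j<e. if j = i then a j - a' j else 0)"
        unfolding p_def using q by (auto simp: coeff_sum intro!: sum.cong)
      then show ?thesis using that \<open>p = 0\<close> by simp
    qed
    then show "a = a'" using a unfolding A_def by (intro PiE_ext[of a _ _ a']) auto
  qed
  \<comment> \<open>As \<open>e \<le> k\<close>, all of \<open>coord_space k\<close> can serve as
    \<open>Y\<close>, so distinct coefficient tuples give distinct maps.\<close>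
  have "card (coord_space k :: (nat \<Rightarrow> 'a) set) \<ge> q ^ e"
    unfolding card_coord_space q_def[symmetric] using q assms by (intro power_increasing) auto
  then have inj: "inj_on F A"
    by (intro inj_onI uniq[where Y = "coord_space k"]) auto
  have lin: "fn_linear (F a)" if a: "a \<in> A" for a
    unfolding fn_linear_iff
  proof (intro conjI allI)
    fix x y :: "nat \<Rightarrow> 'a" and c :: 'a
    have pw: "(u + v) ^ (q ^ i) = u ^ (q ^ i) + v ^ (q ^ i)" for u v :: "'a alg_closure" and i
      unfolding q_def by (rule alg_closure_frobenius_power_add)
    show "F a (x + y) = F a x + F a y"
    proof (rule \<phi>_inj)
      show "\<phi> (F a (x + y)) = \<phi> (F a x + F a y)"
        unfolding add \<phi>F[OF a] P_def pw by (simp add: algebra_simps sum.distrib)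
    qed (use F_co[OF a] in \<open>auto intro: fn.subspace_add\<close>)
    have pc: "to_ac c ^ (q ^ i) = to_ac c" for i
      unfolding q_def by (rule to_ac_power_card_power)
    show "F a (fscale c x) = fscale c (F a x)"
    proof (rule \<phi>_inj)
      show "\<phi> (F a (fscale c x)) = \<phi> (fscale c (F a x))"
        unfolding scale \<phi>F[OF a] P_def power_mult_distrib pc by (simp add: algebra_simps sum_distrib_left)
    qed (use F_co[OF a] in \<open>auto intro: fn.subspace_scale\<close>)
  qed
  show thesis
  proof (rule that[of "F ` A"])
    show "finite (F ` A)"
      unfolding A_def using card_ac_subfield(1)[OF w] by (auto intro: finite_PiE)
    have "card (F ` A) = card A" using inj by (rule card_image)
    also have "\<dots> = card ?L ^ e" by (simp add: A_def card_PiE)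
    also have "\<dots> = card (UNIV :: 'a set) ^ (w * e)"
      by (simp only: card_ac_subfield(2)[OF w] power_mult)
    finally show "card (F ` A) = card (UNIV :: 'a set) ^ (w * e)" .
    fix f g and Y :: "(nat \<Rightarrow> 'a) set"
    assume f: "f \<in> F ` A" and g: "g \<in> F ` A" and Y: "Y \<subseteq> coord_space k" "card Y \<ge> card (UNIV :: 'a set) ^ e"
      and eq: "\<And>y. y \<in> Y \<Longrightarrow> f y = g y"
    obtain a b where "a \<in> A" "b \<in> A" "f = F a" "g = F b" using f g by auto
    with uniq[of a b Y] Y eq show "f = g" by (simp add: q_def)
  qed (use lin F_co in auto)
qed

section \<open>The lower bounds\<close>

text \<open>The \<open>j\<close>-th block of coordinates carries a code of minimum rank distance \<open>(j + 1) * t\<close>.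
  Hence codewords agreeing on a subspace of codimension \<open>r\<close> differ only in the blocks with
  \<open>(j + 1) * t \<le> r\<close>, that is, among the first \<open>m * r\<close> coordinates.\<close>
lemma layered_rank_code:
  fixes k m t :: nat
  assumes t: "0 < t" "k \<le> m * t" and k: "0 < k"
  obtains G :: "((nat \<Rightarrow> 'a::{field,finite}) \<Rightarrow> nat \<Rightarrow> 'a) set"
  where "finite G"
    and "card G = card (UNIV :: 'a set) ^ (\<Sum>j<k div t. m * t * (k + 1 - (j + 1) * t))"
    and "\<And>g. g \<in> G \<Longrightarrow> fn_linear g"
    and "\<And>g v. g \<in> G \<Longrightarrow> g v \<in> coord_space (m * k)"
    and "\<And>g h Y r v i. g \<in> G \<Longrightarrow> h \<in> G \<Longrightarrow> Y \<subseteq> coord_space k \<Longrightarrow>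
      card Y \<ge> card (UNIV :: 'a set) ^ (k - r) \<Longrightarrow> (\<And>y. y \<in> Y \<Longrightarrow> g y = h y) \<Longrightarrow>
      m * r \<le> i \<Longrightarrow> g v i = h v i"
proof -
  define q where "q = card (UNIV :: 'a set)"
  have q: "1 < q" unfolding q_def by (rule one_less_card_UNIV_field)
  define w where "w = m * t"
  \<comment> \<open>Further layers would demand a rank distance above \<open>k\<close>.\<close>
  define J where "J = k div t"
  \<comment> \<open>Distinct maps of the \<open>j\<close>-th code agree on a subspace of dimension
    at most \<open>e j - 1\<close>, which is \<open>k\<close> minus the wanted distance; hence the
    extra 1.\<close>
  define e where "e j = k + 1 - (j + 1) * t" for j
  have w: "k \<le> w" using t by (simp add: w_def)
  then have w0: "0 < w" using k by simp
  have Jt: "(j + 1) * t \<le> k" if "j < J" for j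
  proof -
    have "(j + 1) * t \<le> J * t" using that by (intro mult_le_mono1) simp
    also have "\<dots> \<le> k" unfolding J_def by (rule div_times_less_eq_dividend)
    finally show ?thesis .
  qed
  have e: "0 < e j" "e j \<le> k" if "j < J" for j
    using Jt[OF that] t(1) by (auto simp: e_def)
  \<comment> \<open>The guarantees of \<open>gabidulin_code\<close> form one predicate, so that a
    code can be chosen for all layers at once.\<close>
  define code where "code j C \<longleftrightarrow> finite C \<and> card C = q ^ (w * e j) \<and> (\<forall>f\<in>C. fn_linear f) \<and>
    (\<forall>f\<in>C. \<forall>v. f v \<in> coord_space w) \<and>
    (\<forall>f\<in>C. \<forall>g\<in>C. \<forall>Y\<subseteq>coord_space k. card Y \<ge> q ^ e j \<longrightarrow> (\<forall>y\<in>Y. f y = g y) \<longrightarrow> f = g)"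
    for j and C :: "((nat \<Rightarrow> 'a) \<Rightarrow> nat \<Rightarrow> 'a) set"
  have "\<exists>C. code j C" if "j < J" for j
  proof (rule gabidulin_code[OF e[OF that] w, where 'a = 'a])
    fix D :: "((nat \<Rightarrow> 'a) \<Rightarrow> nat \<Rightarrow> 'a) set"
    assume "finite D" "card D = card (UNIV :: 'a set) ^ (w * e j)"
      and "\<And>f. f \<in> D \<Longrightarrow> fn_linear f" and "\<And>f v. f \<in> D \<Longrightarrow> f v \<in> coord_space w"
      and sep: "\<And>f g Y. f \<in> D \<Longrightarrow> g \<in> D \<Longrightarrow> Y \<subseteq> coord_space k \<Longrightarrow>
        card Y \<ge> card (UNIV :: 'a set) ^ e j \<Longrightarrow> (\<And>y. y \<in> Y \<Longrightarrow> f y = g y) \<Longrightarrow> f = g"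
    then have "code j D"
      unfolding code_def q_def by (intro conjI ballI allI impI) (assumption | simp)+
    then show ?thesis ..
  qed
  then obtain C where C: "\<And>j. j < J \<Longrightarrow> code j (C j)" by metis
  define glue where "glue F v i = (if i < J * w then F (i div w) v (i mod w) else 0)"
    for F :: "nat \<Rightarrow> (nat \<Rightarrow> 'a) \<Rightarrow> nat \<Rightarrow> 'a" and v :: "nat \<Rightarrow> 'a" and i
  define P where "P = (\<Pi>\<^sub>E j\<in>{..<J}. C j)"
  have F_code: "F j \<in> C j" if "F \<in> P" "j < J" for F j using that by (auto simp: P_def)
  have F_zero: "F j v i = 0" if "F \<in> P" "j < J" "w \<le> i" for F j v i
    using C[OF that(2)] F_code[OF that(1,2)] that(3) by (auto simp: code_def coord_space_def)
  \<comment> \<open>The glued map determines each block: coordinates below \<open>w\<close> are read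
    off, and those from \<open>w\<close> on are zero. This gives injectivity and transfers agreement
    on \<open>Y\<close> to the blocks.\<close>
  have glue_block: "F j v = F' j v"
    if F: "F \<in> P" "F' \<in> P" and eq: "glue F v = glue F' v" and j: "j < J" for F F' v j
  proof
    fix i
    show "F j v i = F' j v i"
    proof (cases "i < w")
      case True
      have "j * w + i < (j + 1) * w" using True by simp
      also have "\<dots> \<le> J * w" using j by (intro mult_le_mono1) simp
      finally have "j * w + i < J * w" .
      then show ?thesis
        using fun_cong[OF eq, of "j * w + i"] True by (simp add: glue_def)
    next
      case False
      then show ?thesis using F_zero[OF F(1) j, of i v] F_zero[OF F(2) j, of i v] by simp
    qed
  qed
  have inj: "inj_on glue P"
  proof (rule inj_onI)
    fix F F' assume F: "F \<in> P" "F' \<in> P" and eq: "glue F = glue F'"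
    have "F j = F' j" if "j < J" for j
      using glue_block[OF F _ that] eq by auto
    then show "F = F'" using F unfolding P_def by (intro PiE_ext[of F _ _ F']) auto
  qed
  show thesis
  proof (rule that[of "glue ` P"])
    have fin: "finite (C j)" if "j < J" for j using C[OF that] by (simp add: code_def)
    show "finite (glue ` P)" unfolding P_def using fin by (intro finite_imageI finite_PiE) auto
    have "card (glue ` P) = (\<Prod>j<J. card (C j))"
      unfolding card_image[OF inj] by (simp add: P_def card_PiE)
    also have "\<dots> = (\<Prod>j<J. q ^ (w * e j))"
      using C by (intro prod.cong) (auto simp: code_def)
    also have "\<dots> = q ^ (\<Sum>j<J. w * e j)" by (simp add: power_sum)
    finally show "card (glue ` P) = card (UNIV :: 'a set) ^ (\<Sum>j<k div t. m * t * (k + 1 - (j + 1) * t))"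
      by (simp add: q_def J_def e_def w_def)
  next
    fix g assume "g \<in> glue ` P"
    then obtain F where F: "F \<in> P" "g = glue F" by auto
    have lin: "fn_linear (F (i div w))" if "i < J * w" for i
      using C[of "i div w"] F_code[OF F(1), of "i div w"] less_mult_imp_div_less[OF that]
      by (simp add: code_def)
    show "fn_linear g"
      using lin unfolding fn_linear_iff F(2)
      by (auto simp: fun_eq_iff glue_def fscale_def)
    have "J * w \<le> m * k"
    proof -
      have "J * t \<le> k" unfolding J_def by (rule div_times_less_eq_dividend)
      then have "m * (J * t) \<le> m * k" by (rule mult_le_mono2)
      then show ?thesis by (simp add: w_def algebra_simps)
    qed
    then show "g v \<in> coord_space (m * k)" for v
      by (simp add: F(2) glue_def coord_space_def)
  next
    fix g h r v i and Y :: "(nat \<Rightarrow> 'a) set"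
    assume "g \<in> glue ` P" "h \<in> glue ` P" and Y: "Y \<subseteq> coord_space k" "card (UNIV :: 'a set) ^ (k - r) \<le> card Y"
      and eq: "\<And>y. y \<in> Y \<Longrightarrow> g y = h y" and i: "m * r \<le> i"
    then obtain F F' where F: "F \<in> P" "F' \<in> P" "g = glue F" "h = glue F'" by auto
    show "g v i = h v i"
    proof (cases "i < J * w")
      case True
      define j where "j = i div w"
      have j: "j < J" unfolding j_def using True by (rule less_mult_imp_div_less)
      \<comment> \<open>Coordinate \<open>i\<close> is at least \<open>m * r\<close> and lies below
        the end of block \<open>j\<close>. The bound gives \<open>e j \<le> k - r\<close>, so
        \<open>Y\<close> is large enough to force equality in that block.\<close>
      have "r < (j + 1) * t"
      proof (rule ccontr)
        assume "\<not> ?thesis"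
        then have "m * ((j + 1) * t) \<le> m * r" by (intro mult_le_mono2) simp
        moreover have "i < (j + 1) * w"
          unfolding j_def using w0 by (simp add: dividend_less_div_times add.commute)
        ultimately show False using i by (simp add: w_def algebra_simps)
      qed
      then have "e j \<le> k - r" by (simp add: e_def)
      then have "q ^ e j \<le> q ^ (k - r)" using q by (intro power_increasing) auto
      then have "q ^ e j \<le> card Y" using Y(2) by (simp add: q_def)
      moreover have "\<forall>y\<in>Y. F j y = F' j y" using glue_block[OF F(1,2) _ j] eq F by simp
      ultimately have "F j = F' j"
        using C[OF j] F_code[OF F(1) j] F_code[OF F(2) j] Y(1) unfolding code_def by meson
      then show ?thesis by (simp add: F glue_def j_def)
    next
      case False
      then show ?thesis by (simp add: F glue_def)
    qed
  qed
qed

lemma coord_space_expand: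
  assumes "v \<in> coord_space k"
  shows "v = (\<Sum>i<k. fscale (v i) (\<lambda>j. if j = i then 1 else 0))"
proof
  fix j
  have "(\<Sum>i\<in>A. fscale (v i) (\<lambda>j. if j = i then 1 else 0)) j = (\<Sum>i\<in>A. if i = j then v i else 0)"
    if "finite A" for A
    using that by (induction A rule: finite_induct) (auto simp: fscale_def)
  then show "v j = (\<Sum>i<k. fscale (v i) (\<lambda>j. if j = i then 1 else 0)) j"
    using assms by (simp add: coord_space_def)
qed

text \<open>On \<open>coord_space k\<close> the first output coordinate of a linear map is a
  functional, fixed by its values at the \<open>k\<close> unit vectors. By averaging, one of the
  \<open>q ^ k\<close> value tuples is shared by enough maps.\<close>

lemma fiber_first_coordinate:
  fixes G :: "((nat \<Rightarrow> 'a::{field,finite}) \<Rightarrow> nat \<Rightarrow> 'a) set"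
  assumes "finite G" and lin: "\<And>g. g \<in> G \<Longrightarrow> fn_linear g"
  obtains G' where "G' \<subseteq> G" and "card G \<le> card G' * card (UNIV :: 'a set) ^ k"
    and "\<And>g h v. g \<in> G' \<Longrightarrow> h \<in> G' \<Longrightarrow> v \<in> coord_space k \<Longrightarrow> g v 0 = h v 0"
proof -
  let ?u = "\<lambda>i j. if j = i then 1 else 0 :: 'a"
  let ?B = "{..<k} \<rightarrow>\<^sub>E (UNIV :: 'a set)"
  define \<kappa> where "\<kappa> g = restrict (\<lambda>i. g (?u i) 0) {..<k}" for g :: "(nat \<Rightarrow> 'a) \<Rightarrow> nat \<Rightarrow> 'a"
  have img: "\<kappa> ` G \<subseteq> ?B" by (simp add: \<kappa>_def image_subset_iff)
  have finB: "finite ?B" by (intro finite_PiE) auto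
  have ne: "?B \<noteq> {}" by (simp add: PiE_eq_empty_iff)
  have "\<exists>y\<in>?B. card G \<le> card {g \<in> G. \<kappa> g = y} * card ?B"
  proof (rule ccontr)
    assume "\<not> ?thesis"
    then have "(\<Sum>y\<in>?B. card {g \<in> G. \<kappa> g = y} * card ?B) < (\<Sum>y\<in>?B. card G)"
      by (intro sum_strict_mono finB ne) (meson not_le)
    moreover have "(\<Sum>y\<in>?B. card {g \<in> G. \<kappa> g = y}) = card G"
      using sum.group[OF assms(1) finB img, of "\<lambda>_. 1 :: nat"] by simp
    then have "(\<Sum>y\<in>?B. card {g \<in> G. \<kappa> g = y} * card ?B) = card G * card ?B"
      by (simp only: sum_distrib_right[symmetric])
    ultimately show False by simp
  qed
  then obtain y where y: "card G \<le> card {g \<in> G. \<kappa> g = y} * card ?B" ..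
  show thesis
  proof (rule that[of "{g \<in> G. \<kappa> g = y}"])
    show "card G \<le> card {g \<in> G. \<kappa> g = y} * card (UNIV :: 'a set) ^ k"
      using y by (simp add: card_PiE)
    fix g h :: "(nat \<Rightarrow> 'a) \<Rightarrow> nat \<Rightarrow> 'a" and v :: "nat \<Rightarrow> 'a"
    assume gh: "g \<in> {g \<in> G. \<kappa> g = y}" "h \<in> {g \<in> G. \<kappa> g = y}" and v: "v \<in> coord_space k"
    have val: "f (\<Sum>i\<in>A. fscale (v i) (?u i)) 0 = (\<Sum>i\<in>A. v i * f (?u i) 0)" if "f \<in> G" "finite A" for f A
      using that(2)
    proof (induction A rule: finite_induct)
      case empty
      have "f (fscale 0 0) = fscale 0 (f 0)" using lin[OF that(1)] unfolding fn_linear_iff by blast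
      then show ?case by (simp add: fscale_def)
    next
      case (insert i A)
      have "f (\<Sum>i\<in>insert i A. fscale (v i) (?u i)) =
          fscale (v i) (f (?u i)) + f (\<Sum>i\<in>A. fscale (v i) (?u i))"
        unfolding sum.insert[OF insert.hyps] using lin[OF that(1)] unfolding fn_linear_iff by simp
      then have "f (\<Sum>i\<in>insert i A. fscale (v i) (?u i)) 0 =
          (fscale (v i) (f (?u i)) + f (\<Sum>i\<in>A. fscale (v i) (?u i))) 0"
        by (rule fun_cong)
      also have "\<dots> = v i * f (?u i) 0 + f (\<Sum>i\<in>A. fscale (v i) (?u i)) 0"
        by (simp add: fscale_def)
      finally show ?case unfolding insert.IH sum.insert[OF insert.hyps] .
    qed
    have "g (?u i) 0 = h (?u i) 0" if "i < k" for i
    proof -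
      have "\<kappa> g i = \<kappa> h i" using gh by simp
      then show ?thesis using that by (simp add: \<kappa>_def)
    qed
    then have "(\<Sum>i<k. v i * g (?u i) 0) = (\<Sum>i<k. v i * h (?u i) 0)"
      by (intro sum.cong) auto
    moreover have "f v 0 = (\<Sum>i<k. v i * f (?u i) 0)" if "f \<in> G" for f
      using val[OF that finite_lessThan[of k]] unfolding coord_space_expand[OF v, symmetric] .
    ultimately show "g v 0 = h v 0" using gh by simp
  qed auto
qed

section \<open>Graphs of linear maps as \<open>k\<close>-spaces\<close>

definition graph_vector :: "nat \<Rightarrow> ((nat \<Rightarrow> 'a) \<Rightarrow> nat \<Rightarrow> 'a) \<Rightarrow> (nat \<Rightarrow> 'a) \<Rightarrow> nat \<Rightarrow> 'a" where
  "graph_vector k g x = (\<lambda>i. if i < k then x i else g x (i - k))"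

definition graph_space :: "nat \<Rightarrow> ((nat \<Rightarrow> 'a::field) \<Rightarrow> nat \<Rightarrow> 'a) \<Rightarrow> (nat \<Rightarrow> 'a) set" where
  "graph_space k g = graph_vector k g ` coord_space k"

lemma graph_vector_eqD:
  assumes "graph_vector k g x = graph_vector k h y" and "x \<in> coord_space k" and "y \<in> coord_space k"
  shows "x = y" and "g x = h y"
proof -
  have eq: "graph_vector k g x i = graph_vector k h y i" for i using assms(1) by simp
  have "x i = y i" for i
    using eq[of i] assms(2,3) by (cases "i < k") (auto simp: graph_vector_def coord_space_def)
  then show "x = y" ..
  have "g x i = h y i" for i
    using eq[of "k + i"] by (simp add: graph_vector_def)
  then show "g x = h y" ..
qed

lemma inj_on_graph_vector: "inj_on (graph_vector k g) (coord_space k)"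
  by (rule inj_onI) (rule graph_vector_eqD)

lemma graph_space_in_kspaces:
  fixes g :: "(nat \<Rightarrow> 'a::{field,finite}) \<Rightarrow> nat \<Rightarrow> 'a"
  assumes lin: "fn_linear g" and co: "\<And>v. g v \<in> coord_space M"
  shows "graph_space k g \<in> kspaces (k + M) k"
proof -
  have add: "g (x + y) = g x + g y" and scale: "g (fscale c x) = fscale c (g x)" for x y c
    using lin by (auto simp: fn_linear_iff)
  have ga: "graph_vector k g (x + y) = graph_vector k g x + graph_vector k g y" for x y
    by (auto simp: graph_vector_def add fun_eq_iff)
  have gs: "graph_vector k g (fscale c x) = fscale c (graph_vector k g x)" for c x
    unfolding graph_vector_def scale by (auto simp: fun_eq_iff fscale_def)
  have "fn.subspace (graph_space k g)"
  proof (rule fn.subspaceI)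
    have "graph_vector k g (fscale 0 0) = 0" unfolding gs by simp
    then show "0 \<in> graph_space k g"
      unfolding graph_space_def using fn.subspace_0[OF subspace_coord_space, of k] by force
  next
    fix x y assume "x \<in> graph_space k g" "y \<in> graph_space k g"
    then show "x + y \<in> graph_space k g"
      unfolding graph_space_def
      by (auto simp: ga[symmetric] intro!: imageI fn.subspace_add[OF subspace_coord_space])
  next
    fix c x assume "x \<in> graph_space k g"
    then show "fscale c x \<in> graph_space k g"
      unfolding graph_space_def
      by (auto simp: gs[symmetric] intro!: imageI fn.subspace_scale[OF subspace_coord_space])
  qed
  moreover have "graph_space k g \<subseteq> coord_space (k + M)"
    using co by (auto simp: graph_space_def graph_vector_def coord_space_def)
  moreover have "card (graph_space k g) = card (UNIV :: 'a set) ^ k"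
    unfolding graph_space_def card_image[OF inj_on_graph_vector] by (rule card_coord_space)
  ultimately show ?thesis by (simp add: kspaces_iff_card)
qed

text \<open>If the maps agree on the projection of the kernel, of codimension \<open>r\<close>, then every petal lies in
  the sum of one fixed petal and a space of dimension \<open>(s - 1) * r - 1\<close>: one too few.\<close>
lemma sunflower_free_graph_spaces:
  fixes G :: "((nat \<Rightarrow> 'a::{field,finite}) \<Rightarrow> nat \<Rightarrow> 'a) set"
  assumes s: "s \<ge> 2" and lin: "\<And>g. g \<in> G \<Longrightarrow> fn_linear g"
    and co: "\<And>g v. g \<in> G \<Longrightarrow> g v \<in> coord_space M"
    and sep: "\<And>g h Y r v i. g \<in> G \<Longrightarrow> h \<in> G \<Longrightarrow> Y \<subseteq> coord_space k \<Longrightarrow>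
      card Y \<ge> card (UNIV :: 'a set) ^ (k - r) \<Longrightarrow> (\<And>y. y \<in> Y \<Longrightarrow> g y = h y) \<Longrightarrow>
      (s - 1) * r \<le> i \<Longrightarrow> g v i = h v i"
    and first: "\<And>g h v. g \<in> G \<Longrightarrow> h \<in> G \<Longrightarrow> v \<in> coord_space k \<Longrightarrow> g v 0 = h v 0"
  shows "sunflower_free (k + M) k s (graph_space k ` G)"
  unfolding sunflower_free_def
proof
  define q where "q = card (UNIV :: 'a set)"
  have q: "1 < q" unfolding q_def by (rule one_less_card_UNIV_field)
  assume "\<exists>\<S>\<subseteq>graph_space k ` G. sunflower (k + M) k s \<S>"
  then obtain \<S> where SG: "\<S> \<subseteq> graph_space k ` G" and sf: "sunflower (k + M) k s \<S>"
    by blast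
  have SK: "\<S> \<subseteq> kspaces (k + M) k" and fS: "finite \<S>" and cS: "card \<S> = s"
    using sf unfolding sunflower_def by simp_all
  obtain d K where K: "K \<in> kspaces (k + M) d"
    and "\<forall>S\<in>\<S>. \<forall>T\<in>\<S>. S \<noteq> T \<longrightarrow> S \<inter> T = K"
    and dim: "fn.dim (fn.span (\<Union>\<S>)) = d + s * (k - d)"
    using sf unfolding sunflower_def by (elim conjE exE bexE)
  then have meet: "S \<inter> T = K" if "S \<in> \<S>" "T \<in> \<S>" "S \<noteq> T" for S T using that by simp
  have "\<not> card \<S> \<le> Suc 0" using s cS by simp
  then obtain S1 S2 where S12: "S1 \<in> \<S>" "S2 \<in> \<S>" "S1 \<noteq> S2"
    unfolding card_le_Suc0_iff_eq[OF fS] by blast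
  \<comment> \<open>Every petal differs from \<open>S1\<close> or from \<open>S2\<close>, so it
    contains the kernel.\<close>
  have K_sub: "K \<subseteq> S" if "S \<in> \<S>" for S
    using meet[OF S12(1) that] meet[OF S12(2) that] S12(3) by (cases "S1 = S") auto
  have fin: "finite S" "card S = q ^ k" "fn.subspace S" if "S \<in> \<S>" for S
  proof -
    have "S \<in> kspaces (k + M) k" using that SK by auto
    then show "finite S" "card S = q ^ k" "fn.subspace S"
      by (simp_all add: finite_in_kspaces) (simp_all add: kspaces_iff_card q_def)
  qed
  have cK: "card K = q ^ d" using K by (simp add: kspaces_iff_card q_def)
  have "d \<noteq> k"
  proof
    assume "d = k"
    then have "K = S" if "S \<in> \<S>" for S
      using cK K_sub[OF that] fin(1,2)[OF that] by (intro card_subset_eq) auto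
    from this[OF S12(1)] this[OF S12(2)] S12(3) show False by simp
  qed
  moreover have "q ^ d \<le> q ^ k"
    using card_mono[OF fin(1)[OF S12(1)] K_sub[OF S12(1)]] fin(2)[OF S12(1)] cK by simp
  then have "d \<le> k" using q by simp
  ultimately have dk: "d < k" by simp
  define r where "r = k - d"
  have r: "0 < r" "k - r = d" using dk by (auto simp: r_def)
  obtain g1 where g1: "g1 \<in> G" "S1 = graph_space k g1" using SG S12 by auto
  \<comment> \<open>The projection of the kernel to the first \<open>k\<close> coordinates. The maps
    of all petals agree with \<open>g1\<close> on it, since the kernel lies in every graph.\<close>
  define Y where "Y = {x \<in> coord_space k. graph_vector k g1 x \<in> K}"
  have "K = graph_vector k g1 ` Y"
    using K_sub[OF S12(1)] g1 by (auto simp: Y_def graph_space_def)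
  moreover have "inj_on (graph_vector k g1) Y"
    by (rule inj_on_subset[OF inj_on_graph_vector]) (auto simp: Y_def)
  ultimately have cY: "card Y = q ^ (k - r)" using cK r by (simp add: card_image)
  \<comment> \<open>Differences of the maps live in the coordinates \<open>k + i\<close> with
    \<open>i < (s - 1) * r\<close>. Coordinate \<open>k\<close> is excluded too, because all maps
    share their first output coordinate; this is the missing dimension.\<close>
  define Z where "Z = {v :: nat \<Rightarrow> 'a. \<forall>i. i \<le> k \<or> k + (s - 1) * r \<le> i \<longrightarrow> v i = 0}"
  have subZ: "fn.subspace Z" by (auto simp: Z_def fn.subspace_def fscale_def)
  let ?sh = "\<lambda>z i. if i \<le> k then 0 else z (i - (k + 1)) :: 'a"
  have "Z \<subseteq> ?sh ` coord_space ((s - 1) * r - 1)"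
  proof
    fix v assume v: "v \<in> Z"
    have "v = ?sh (\<lambda>i. v (i + (k + 1)))" using v by (auto simp: Z_def fun_eq_iff)
    moreover have "(\<lambda>i. v (i + (k + 1))) \<in> coord_space ((s - 1) * r - 1)"
      using v by (auto simp: Z_def coord_space_def)
    ultimately show "v \<in> ?sh ` coord_space ((s - 1) * r - 1)" by (rule image_eqI)
  qed
  then have finZ: "finite Z" and cZ: "card Z \<le> q ^ ((s - 1) * r - 1)"
    using surj_card_le[of "coord_space ((s - 1) * r - 1)" Z ?sh]
    by (auto simp: card_coord_space q_def intro: finite_subset)
  \<comment> \<open>A vector of \<open>S\<close> is compared with the vector of \<open>S1\<close>
    above the same \<open>v\<close>; their difference lies in \<open>Z\<close>.\<close>
  have "S \<subseteq> fn.span (S1 \<union> Z)" if S: "S \<in> \<S>" for S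
  proof
    obtain g where g: "g \<in> G" "S = graph_space k g" using SG S by auto
    have agree: "g1 y = g y" if y: "y \<in> Y" for y
    proof -
      have "graph_vector k g1 y \<in> graph_space k g" using K_sub[OF S] g y by (auto simp: Y_def)
      then obtain x where "x \<in> coord_space k" "graph_vector k g1 y = graph_vector k g x"
        by (auto simp: graph_space_def)
      then show ?thesis using graph_vector_eqD[of k g1 y g x] y by (auto simp: Y_def)
    qed
    have high: "g1 v i = g v i" if "(s - 1) * r \<le> i" for v i
      by (rule sep[OF g1(1) g(1), of Y r]) (use cY agree that in \<open>auto simp: Y_def q_def\<close>)
    fix x assume "x \<in> S"
    then obtain v where v: "v \<in> coord_space k" "x = graph_vector k g v"
      using g by (auto simp: graph_space_def)
    have "x - graph_vector k g1 v \<in> Z"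
      unfolding Z_def v(2) graph_vector_def
      using high first[OF g1(1) g(1) v(1)] by auto
    moreover have "graph_vector k g1 v \<in> S1" using v g1 by (auto simp: graph_space_def)
    ultimately have "graph_vector k g1 v + (x - graph_vector k g1 v) \<in> fn.span (S1 \<union> Z)"
      by (intro fn.span_add fn.span_base) auto
    then show "x \<in> fn.span (S1 \<union> Z)" by simp
  qed
  then have sub: "fn.span (\<Union>\<S>) \<subseteq> fn.span (S1 \<union> Z)"
    by (intro fn.span_minimal) auto
  have sum: "card (fn.span (S1 \<union> Z)) * card (S1 \<inter> Z) = card S1 * card Z"
    using fn.card_subspace_sum[OF fin(3,1)[OF S12(1)] subZ finZ] .
  have "0 \<in> S1 \<inter> Z" using fn.subspace_0 fin(3)[OF S12(1)] subZ by blast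
  then have i0: "0 < card (S1 \<inter> Z)" using finZ by (auto simp: card_gt_0_iff)
  \<comment> \<open>An infinite set has \<open>card\<close> 0, whereas \<open>sum\<close> makes this
    cardinality positive.\<close>
  have finspan: "finite (fn.span (S1 \<union> Z))"
  proof -
    have "0 < card S1 * card Z"
      using fin[OF S12(1)] finZ q subZ fn.subspace_0[OF subZ] by (auto simp: card_gt_0_iff)
    then have "card (fn.span (S1 \<union> Z)) \<noteq> 0" unfolding sum[symmetric] by simp
    then show ?thesis by (rule contrapos_np) (rule card.infinite)
  qed
  have "q ^ (d + s * (k - d)) = card (fn.span (\<Union>\<S>))"
    using fn.card_subspace[OF finite fn.subspace_span finite_subset[OF sub finspan]] dim
    by (simp add: q_def)
  also have "\<dots> \<le> card (fn.span (S1 \<union> Z))" using sub finspan by (intro card_mono)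
  also have "\<dots> \<le> card (fn.span (S1 \<union> Z)) * card (S1 \<inter> Z)" using i0 by simp
  also have "\<dots> \<le> q ^ k * q ^ ((s - 1) * r - 1)"
    unfolding sum fin(2)[OF S12(1)] using cZ by simp
  also have "\<dots> = q ^ (k + ((s - 1) * r - 1))" by (simp add: power_add)
  \<comment> \<open>Since \<open>k = d + r\<close>, the left-hand side is
    \<open>k + (s - 1) * r\<close>, one more than the right-hand side.\<close>
  finally have "d + s * r \<le> k + ((s - 1) * r - 1)" using q by (simp add: r_def)
  moreover have "s * r = (s - 1) * r + r" using s by (cases s) auto
  moreover have "0 < (s - 1) * r" using s r by simp
  moreover have "k = d + r" using dk by (simp add: r_def)
  ultimately show False by linarith
qed

text \<open>The condition on \<open>t\<close> makes the block length \<open>(s - 1) * t\<close> at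
  least \<open>k\<close>, as the Gabidulin codes require. The factor \<open>q ^ k\<close> on the
  right is the price of fixing the first coordinate.\<close>

lemma large_sunflower_free_family:
  fixes s k t :: nat
  assumes s: "s \<ge> 2" and k: "0 < k" and t: "0 < t" "k \<le> (s - 1) * t"
  obtains \<F> :: "(nat \<Rightarrow> 'a::{field,finite}) set set"
  where "\<F> \<subseteq> kspaces (k + (s - 1) * k) k" and "sunflower_free (k + (s - 1) * k) k s \<F>"
    and "card (UNIV :: 'a set) ^ (\<Sum>j<k div t. (s - 1) * t * (k + 1 - (j + 1) * t))
      \<le> card \<F> * card (UNIV :: 'a set) ^ k"
proof (rule layered_rank_code[OF t k, where 'a = 'a])
  let ?q = "card (UNIV :: 'a set)" and ?M = "(s - 1) * k"
  fix G :: "((nat \<Rightarrow> 'a) \<Rightarrow> nat \<Rightarrow> 'a) set"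
  assume fin: "finite G"
    and card: "card G = ?q ^ (\<Sum>j<k div t. (s - 1) * t * (k + 1 - (j + 1) * t))"
    and lin: "\<And>g. g \<in> G \<Longrightarrow> fn_linear g"
    and co: "\<And>g v. g \<in> G \<Longrightarrow> g v \<in> coord_space ?M"
    and sep: "\<And>g h Y r v i. g \<in> G \<Longrightarrow> h \<in> G \<Longrightarrow> Y \<subseteq> coord_space k \<Longrightarrow>
      card Y \<ge> ?q ^ (k - r) \<Longrightarrow> (\<And>y. y \<in> Y \<Longrightarrow> g y = h y) \<Longrightarrow>
      (s - 1) * r \<le> i \<Longrightarrow> g v i = h v i"
  obtain G' where G': "G' \<subseteq> G" "card G \<le> card G' * ?q ^ k"
    and first: "\<And>g h v. g \<in> G' \<Longrightarrow> h \<in> G' \<Longrightarrow> v \<in> coord_space k \<Longrightarrow> g v 0 = h v 0"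
    using fiber_first_coordinate[OF fin lin, of k] by blast
  \<comment> \<open>A graph records a map only on \<open>coord_space k\<close>; \<open>sep\<close>
    with \<open>r = 0\<close> extends the agreement to all vectors.\<close>
  have "inj_on (graph_space k) G"
  proof (rule inj_onI)
    fix g h assume g: "g \<in> G" and h: "h \<in> G" and eq: "graph_space k g = graph_space k h"
    have "g y = h y" if "y \<in> coord_space k" for y
    proof -
      have "graph_vector k g y \<in> graph_space k h" using eq that by (auto simp: graph_space_def)
      then obtain x where "x \<in> coord_space k" "graph_vector k g y = graph_vector k h x"
        by (auto simp: graph_space_def)
      then show ?thesis using graph_vector_eqD[of k g y h x] that by auto
    qed
    then have "g v i = h v i" for v i
      by (intro sep[OF g h, of "coord_space k" 0]) (auto simp: card_coord_space)
    then show "g = h" by (intro ext)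
  qed
  then have "card (graph_space k ` G') = card G'"
    using G'(1) by (intro card_image) (rule inj_on_subset)
  show thesis
  proof (rule that[of "graph_space k ` G'"])
    show "graph_space k ` G' \<subseteq> kspaces (k + ?M) k"
      using G' lin co by (auto intro!: graph_space_in_kspaces)
    show "sunflower_free (k + ?M) k s (graph_space k ` G')"
    proof (rule sunflower_free_graph_spaces[OF s])
      show "fn_linear g" "g v \<in> coord_space ?M" if "g \<in> G'" for g v
        using that G' lin co by auto
      show "g v i = h v i" if "g \<in> G'" "h \<in> G'" "Y \<subseteq> coord_space k" "?q ^ (k - r) \<le> card Y"
        "\<And>y. y \<in> Y \<Longrightarrow> g y = h y" "(s - 1) * r \<le> i" for g h Y r v i
        using that G'(1) by (intro sep[of g h Y r i v]) auto
    qed (rule first)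
    show "?q ^ (\<Sum>j<k div t. (s - 1) * t * (k + 1 - (j + 1) * t)) \<le> card (graph_space k ` G') * ?q ^ k"
      using G'(2) card \<open>card (graph_space k ` G') = card G'\<close> by simp
  qed
qed

section \<open>Arithmetic of the exponent\<close>

lemma twice_sum_layers:
  fixes k m t :: nat
  assumes t: "0 < t"
  shows "2 * real (\<Sum>j<k div t. m * t * (k + 1 - (j + 1) * t)) =
    real m * (real k * (real k + 1) - real (k - k mod t) * (real t - 1) - real (k mod t) * (real (k mod t) + 1))"
proof -
  \<comment> \<open>The sum is first evaluated over the reals for arbitrary \<open>J\<close>, where
    subtraction does not truncate; afterwards \<open>J * t = k - k mod t\<close>.\<close>
  have sum: "2 * (\<Sum>j<J. real m * t * (real k + 1 - (real j + 1) * t)) =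
      real m * (real J * t) * (2 * real k + 2 - real J * t - t)" for J
    by (induction J) (auto simp: algebra_simps)
  define J r where "J = k div t" and "r = k mod t"
  have k: "k = J * t + r" unfolding J_def r_def by simp
  have "real (k + 1 - (j + 1) * t) = real k + 1 - (real j + 1) * t" if "j < J" for j
  proof -
    have "(j + 1) * t \<le> J * t" using that by (intro mult_le_mono1) simp
    then have "(j + 1) * t \<le> k + 1" using k by simp
    then show ?thesis by (simp only: of_nat_diff) (simp add: algebra_simps)
  qed
  then have "2 * real (\<Sum>j<J. m * t * (k + 1 - (j + 1) * t)) =
      2 * (\<Sum>j<J. real m * t * (real k + 1 - (real j + 1) * t))"
    unfolding of_nat_sum by (intro arg_cong[of _ _ "(*) 2"] sum.cong) (auto simp del: of_nat_diff)
  also have "\<dots> = real m * (real J * t) * (2 * real k + 2 - real J * t - t)" by (rule sum)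
  also have "\<dots> = real m * (real k * (real k + 1) - real (k - r) * (real t - 1) - real r * (real r + 1))"
    unfolding k by (simp add: algebra_simps)
  finally show ?thesis unfolding J_def r_def .
qed

text \<open>Here \<open>t\<close> is \<open>k / m\<close> rounded up. Doubled, the loss against the
  case \<open>t = 1\<close> is at most \<open>m * (t - 1) * (k + 1)\<close>, and divisibility by the
  gcd sharpens \<open>m * (t - 1) < k\<close> to
  \<open>m * (t - 1) \<le> k - gcd k m\<close>.\<close>

lemma sum_layers_ge:
  fixes k m :: nat
  assumes "0 < m" and "0 < k"
  defines "t \<equiv> (k - 1) div m + 1"
  shows "real m * (real k * (real k + 1)) - (real k - real (gcd k m)) * (real k + 1) \<le>
    2 * real (\<Sum>j<k div t. m * t * (k + 1 - (j + 1) * t))"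
proof -
  define g where "g = gcd k m"
  have mt: "m * (t - 1) \<le> k - g"
  proof -
    have "m * (t - 1) \<le> k - 1"
      unfolding t_def using times_div_less_eq_dividend[of m "k - 1"] by simp
    then have lt: "m * (t - 1) < k" using \<open>0 < k\<close> by linarith
    have "g dvd k - m * (t - 1)" unfolding g_def by (intro dvd_diff_nat) auto
    then have "g \<le> k - m * (t - 1)" using lt by (intro dvd_imp_le) auto
    then show ?thesis using lt by simp
  qed
  have gk: "g \<le> k" unfolding g_def using assms by (intro gcd_le1_nat) simp
  have t0: "0 < t" by (simp add: t_def)
  define r where "r = k mod t"
  have "r < t" unfolding r_def using t0 by (rule mod_less_divisor)
  then have r: "r \<le> t - 1" "r \<le> k" by (simp_all add: r_def)
  \<comment> \<open>Replacing one factor \<open>r\<close> by \<open>t - 1\<close> merges the two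
    loss terms into \<open>(t - 1) * (k + 1)\<close>.\<close>
  have "real (k - r) * (real t - 1) + real r * (real r + 1) \<le>
      real (k - r) * (real t - 1) + (real t - 1) * (real r + 1)"
    using r t0 by (intro add_left_mono mult_right_mono) auto
  also have "\<dots> = (real t - 1) * (real k + 1)"
    using r by (simp add: of_nat_diff algebra_simps)
  finally have "real m * (real (k - r) * (real t - 1) + real r * (real r + 1)) \<le>
      real m * ((real t - 1) * (real k + 1))"
    by (intro mult_left_mono) auto
  also have "\<dots> = real (m * (t - 1)) * (real k + 1)"
    using t0 by (simp add: of_nat_diff)
  also have "\<dots> \<le> real (k - g) * (real k + 1)"
    using mt by (intro mult_right_mono) (auto simp del: of_nat_mult)
  also have "\<dots> = (real k - real g) * (real k + 1)"
    using gk by (simp add: of_nat_diff)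
  finally show ?thesis
    unfolding twice_sum_layers[OF t0] r_def[symmetric] g_def[symmetric]
    by (simp add: algebra_simps)
qed

lemma real_choose_two: "real ((k + 1) choose 2) = real k * (real k + 1) / 2"
  by (induction k) (auto simp: numeral_2_eq_2 field_simps)

theorem theorem1p3:
  fixes s k q :: nat
  assumes "s \<ge> 3" and "k \<ge> 2"
    and "q = card (UNIV :: 'a::{field,finite} set)"
  shows
    "(\<forall>n>0. \<forall>\<F> :: (nat \<Rightarrow> 'a) set set.
        \<F> \<subseteq> kspaces n k \<and> sunflower_free n k s \<F> \<longrightarrow>
          real (card \<F>) \<le> (\<Prod>i=1..k. qint q (i * (s - 1))) \<and>
          (\<Prod>i=1..k. qint q (i * (s - 1))) \<le>
            (real q / (real q - 1)) ^ k *
            real q powr ((real s - 1) * real ((k + 1) choose 2) - real k)) \<and>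
     (\<exists>n>0. \<exists>\<F> :: (nat \<Rightarrow> 'a) set set.
        \<F> \<subseteq> kspaces n k \<and> sunflower_free n k s \<F> \<and>
        (s \<ge> k + 1 \<longrightarrow>
          real (card \<F>) \<ge> real q powr ((real s - 1) * real ((k + 1) choose 2) - real k)) \<and>
        (s \<le> k \<longrightarrow>
          real (card \<F>) \<ge> real q powr ((real s - 2) * real ((k + 1) choose 2)
                                   + real k * ((real (gcd k (s - 1)) - 3) / 2)) \<and>
          real q powr ((real s - 2) * real ((k + 1) choose 2)
                                   + real k * ((real (gcd k (s - 1)) - 3) / 2))
            \<ge> real q powr ((real s - 2) * real ((k + 1) choose 2) - real k)))"
proof (intro conjI allI impI)
  have q: "1 < q" unfolding assms(3) by (rule one_less_card_UNIV_field)
  show "real (card \<F>) \<le> (\<Prod>i=1..k. qint q (i * (s - 1)))"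
    if "\<F> \<subseteq> kspaces n k \<and> sunflower_free n k s \<F>" for n and \<F> :: "(nat \<Rightarrow> 'a) set set"
    using card_sunflower_free_le[of s \<F> n k] that assms by simp
  show "(\<Prod>i=1..k. qint q (i * (s - 1))) \<le> (real q / (real q - 1)) ^ k *
      real q powr ((real s - 1) * real ((k + 1) choose 2) - real k)"
    using prod_qint_le[OF q] assms(1) by simp
  \<comment> \<open>\<open>t\<close> is the least integer with \<open>k \<le> m * t\<close>, so the
    blocks are as short as the Gabidulin codes permit.\<close>
  define m t E where "m = s - 1" and "t = (k - 1) div m + 1"
    and "E = (\<Sum>j<k div t. m * t * (k + 1 - (j + 1) * t))"
  define g where "g = gcd k m"
  have m: "0 < m" "real m = real s - 1" using assms by (auto simp: m_def)
  have g: "1 \<le> g" using m by (simp add: g_def Suc_le_eq)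
  have t: "0 < t" "k \<le> (s - 1) * t"
  proof -
    show "0 < t" by (simp add: t_def)
    have "k - 1 < m * t"
      unfolding t_def using m(1) by (metis Suc_eq_plus1 dividend_less_times_div mult_Suc_right)
    then show "k \<le> (s - 1) * t" by (simp add: m_def)
  qed
  have "s \<ge> 2" "0 < k" using assms by auto
  then show "\<exists>n>0. \<exists>\<F> :: (nat \<Rightarrow> 'a) set set.
      \<F> \<subseteq> kspaces n k \<and> sunflower_free n k s \<F> \<and>
        (s \<ge> k + 1 \<longrightarrow>
          real (card \<F>) \<ge> real q powr ((real s - 1) * real ((k + 1) choose 2) - real k)) \<and>
        (s \<le> k \<longrightarrow>
          real (card \<F>) \<ge> real q powr ((real s - 2) * real ((k + 1) choose 2)
                                   + real k * ((real (gcd k (s - 1)) - 3) / 2)) \<and>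
          real q powr ((real s - 2) * real ((k + 1) choose 2)
                                   + real k * ((real (gcd k (s - 1)) - 3) / 2))
            \<ge> real q powr ((real s - 2) * real ((k + 1) choose 2) - real k))"
  proof (rule large_sunflower_free_family[OF _ _ t, where 'a = 'a])
    fix \<F> :: "(nat \<Rightarrow> 'a) set set"
    assume F: "\<F> \<subseteq> kspaces (k + (s - 1) * k) k" "sunflower_free (k + (s - 1) * k) k s \<F>"
      and card: "card (UNIV :: 'a set) ^ (\<Sum>j<k div t. (s - 1) * t * (k + 1 - (j + 1) * t))
        \<le> card \<F> * card (UNIV :: 'a set) ^ k"
    have "q ^ E \<le> card \<F> * q ^ k" using card unfolding E_def m_def assms(3) .
    then have "real q ^ E \<le> real (card \<F>) * real q ^ k"
      by (metis of_nat_le_iff of_nat_mult of_nat_power)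
    then have qE: "real q powr (real E - real k) \<le> real (card \<F>)"
      using q by (simp add: powr_diff powr_realpow divide_le_eq)
    have large: "real q powr x \<le> real (card \<F>)" if "x \<le> real E - real k" for x
      by (rule order.trans[OF powr_mono[OF that] qE]) (use q in simp)
    have c2: "real ((k + 1) choose 2) = real k * (real k + 1) / 2"
      by (rule real_choose_two)
    have c1: "(real s - 1) * real ((k + 1) choose 2) - real k \<le> real E - real k" if "s \<ge> k + 1"
    proof -
      \<comment> \<open>As \<open>k - 1 < m\<close>, the quotient in \<open>t\<close> is 0. With
        \<open>t = 1\<close> both loss terms vanish and \<open>E\<close> is exactly
        \<open>m * ((k + 1) choose 2)\<close>.\<close>
      have "t = 1" unfolding t_def using that assms by (simp add: m_def)
      then show ?thesis
        using twice_sum_layers[OF t(1), where k = k and m = m]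
        unfolding E_def[symmetric] c2 m(2)[symmetric] by simp
    qed
    have "(real s - 2) * real ((k + 1) choose 2) + real k * ((real g - 3) / 2) \<le> real E - real k"
    proof -
      \<comment> \<open>The left-hand side equals \<open>((s - 2) * k + g) * (k + 1)\<close>, so the
        wanted exponent is reached with \<open>(k + g) / 2\<close> to spare.\<close>
      have "real m * (real k * (real k + 1)) - (real k - real g) * (real k + 1) \<le> 2 * real E"
        using sum_layers_ge[OF m(1) \<open>0 < k\<close>] unfolding E_def t_def g_def .
      then show ?thesis unfolding c2 m(2) by (simp add: field_simps)
    qed
    moreover have "(real s - 2) * real ((k + 1) choose 2) - real k \<le>
        (real s - 2) * real ((k + 1) choose 2) + real k * ((real g - 3) / 2)"
    proof -
      have "real k * (-1) \<le> real k * ((real g - 3) / 2)"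
        using g by (intro mult_left_mono) auto
      then show ?thesis by simp
    qed
    \<comment> \<open>The same family serves both ranges of \<open>s\<close>.\<close>
    ultimately show ?thesis
      using F large c1 q \<open>0 < k\<close> unfolding g_def m_def
      by (intro exI[of _ "k + (s - 1) * k"] conjI exI[of _ \<F>] impI powr_mono) auto
  qed
qed

end
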